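(* Let $\mathcal{D}_2(n)$, $n\ge 3$, be a dihedral group with a constant (nonnegative) multiplicity function $k$. Then, for $x=\rho e^{i\phi}$ and $y=re^{i\theta}$ in the closed dihedral wedge $\overline{C}$, the associated generalized Bessel function is given by $$D_k^{\mathcal{D}_2(n)}(x,y)=\frac{c_{n,k}}{nB(k+1/2,1/2)\Gamma(nk)}\sum_{j\ge 0}\frac{(k)_j(k)_j}{(2k)_j(nk)_{nj}\,j!}\Bigl(-4\bigl(\tfrac{\rho r}{2}\bigr)^n\sin(n\theta)\sin(n\phi)\Bigr)^j\,\Phi_2^{(n)}\bigl(k+j,\dots,k+j;\,nk+nj;\,\rho r\,b_1^{\theta-\phi,n},\dots,\rho r\,b_n^{\theta-\phi,n}\bigr),$$ where $b_s^{\theta-\phi,n}=\cos\bigl(\theta-\phi+\tfrac{2\pi s}{n}\bigr)$ for $s=1,\dots,n$, and the parameter $k+j$ is repeated $n$ times in $\Phi_2^{(n)}$.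
   Context: $(\cdot)_j$ is the Pochhammer symbol; $B(u,v)=\Gamma(u)\Gamma(v)/\Gamma(u+v)$ is the Beta function. $I_\nu(v)=\sum_{m\ge0}\frac{1}{m!\,\Gamma(\nu+m+1)}(v/2)^{2m+\nu}$ is the modified Bessel function of the first kind. $C_j^{(k)}$ is the $j$-th (non orthonormal) Gegenbauer polynomial, with $C_j^{(k)}(1)=(2k)_j/j!$. Generalized Bessel function: $\mathcal{D}_2(n)$ is the group of orthogonal transformations leaving invariant a regular $n$-sided polygon centered at the origin, with positive Weyl chamber (dihedral wedge) $C=\{re^{i\theta}: r>0,\ 0<\theta<\pi/n\}$. Let $x=\rho e^{i\phi}$, $y=re^{i\theta}$ belong to $\overline{C}$. If $n=2p$ with $p\ge2$, a multiplicity function takes two values $(k_0,k_1)$ and the generalized Bessel function is $$D_k^{\mathcal{D}_2(n)}(x,y)=c_{n,k_0,k_1}\Bigl(\frac{2}{r\rho}\Bigr)^{\gamma}\sum_{j\ge0}I_{2jp+\gamma}(\rho r)\,p_j^{(l_1,l_0)}(\cos(2p\phi))\,p_j^{(l_1,l_0)}(\cos(2p\theta)),\qquad \gamma=p(k_0+k_1),$$ where $p_j^{(l_1,l_0)}$ is the $j$-th orthonormal Jacobi polynomial of parameters $l_i=k_i-1/2$, $i\in\{0,1\}$, and $c_{n,k_0,k_1}$ is the normalizing constant subject to $D_k^{\mathcal{D}_2(n)}(0,y)=1$ for all $y\in\overline{C}$. When $k_0=k_1=k$ (constant multiplicity function), this is rewritten, with $c_{n,k}:=c_{n,k,k}$,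 as $$D_k^{\mathcal{D}_2(n)}(x,y)=\frac{c_{n,k}}{B(k+1/2,1/2)}\Bigl(\frac{2}{r\rho}\Bigr)^{nk}\sum_{j\ge0}I_{nj+nk}(\rho r)\,(j+k)\,\frac{C_j^{(k)}(\cos(n\phi))\,C_j^{(k)}(\cos(n\theta))}{C_j^{(k)}(1)}.$$ When $n$ is odd, the multiplicity function takes a single value $k$ and the generalized Bessel function is given by this same last formula, $c_{n,k}$ again being the normalizing constant. Confluent Horn function: $\displaystyle\Phi_2^{(n)}(\beta_1,\dots,\beta_n;\gamma;z_1,\dots,z_n)=\sum_{j_1,\dots,j_n\ge0}\frac{(\beta_1)_{j_1}\cdots(\beta_n)_{j_n}}{(\gamma)_{j_1+\cdots+j_n}}\frac{z_1^{j_1}}{j_1!}\cdots\frac{z_n^{j_n}}{j_n!}.$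
   Formalization: For k = 0 the displayed formula is undefined (Γ(0), and 0/0 from the Pochhammer symbols); there D_0 is taken as the limit of D_κ as κ → 0+, and the claim is that the right-hand side tends to D_0 as κ → 0+. All k > 0 are covered as stated. *)

theory Defs
  imports "HOL-Analysis.Analysis"
begin

text \<open>The (not normalized) Gegenbauer polynomial $C_j^{(k)}$, evaluated at \<open>t\<close>,
  by its three-term recurrence.\<close>

fun gegenbauer :: "nat \<Rightarrow> real \<Rightarrow> real \<Rightarrow> real" where
  "gegenbauer 0 k t = 1"
| "gegenbauer (Suc 0) k t = 2 * k * t"
| "gegenbauer (Suc (Suc j)) k t =
     (2 * (real j + 1 + k) * t * gegenbauer (Suc j) k t - (real j + 2 * k) * gegenbauer j k t)
     / (real j + 2)"

lemma gegenbauer_at_1: "gegenbauer j k 1 = pochhammer (2 * k) j / fact j"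
proof (induction j k "1::real" rule: gegenbauer.induct)
  case (3 j k)
  have "(2 * (real j + 1 + k) * pochhammer (2 * k) (Suc j) / fact (Suc j)
        - (real j + 2 * k) * pochhammer (2 * k) j / fact j) / (real j + 2)
      = pochhammer (2 * k) (Suc (Suc j)) / fact (Suc (Suc j))"
    by (simp add: pochhammer_Suc divide_simps) (simp add: algebra_simps)
  with 3 show ?case by simp
qed simp_all

text \<open>The modified Bessel function of the first kind, used for \<open>v > 0\<close> only
  (\<open>0 powr 0 = 0\<close> makes the value at \<open>v = 0\<close>, \<open>\<nu> = 0\<close> meaningless).\<close>

definition bessel_I :: "real \<Rightarrow> real \<Rightarrow> real" where
  "bessel_I \<nu> v = (\<Sum>m. 1 / (fact m * Gamma (\<nu> + real m + 1)) * (v / 2) powr (2 * real m + \<nu>))"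

text \<open>The confluent Horn function $\Phi_2^{(n)}(\beta_1,\dots,\beta_n;\gamma;z_1,\dots,z_n)$,
  summed over all multi-indices \<open>(j 1, \<dots>, j n)\<close> of natural numbers.\<close>

definition horn_Phi2 ::
  "nat \<Rightarrow> (nat \<Rightarrow> real) \<Rightarrow> real \<Rightarrow> (nat \<Rightarrow> real) \<Rightarrow> real" where
  "horn_Phi2 n \<beta> \<gamma> z =
     (\<Sum>\<^sub>\<infinity>j \<in> {1..n} \<rightarrow>\<^sub>E (UNIV :: nat set).
        (\<Prod>i=1..n. pochhammer (\<beta> i) (j i)) / pochhammer \<gamma> (\<Sum>i=1..n. j i)
        * (\<Prod>i=1..n. z i ^ j i / fact (j i)))"

text \<open>The positive Weyl chamber of the dihedral group $\mathcal{D}_2(n)$.\<close>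

definition dihedral_wedge :: "nat \<Rightarrow> complex set" where
  "dihedral_wedge n = {rcis r \<theta> | r \<theta>. r > 0 \<and> 0 < \<theta> \<and> \<theta> < pi / real n}"

text \<open>The generalized Bessel function for a constant multiplicity \<open>k > 0\<close>, without its
  normalizing constant, in terms of \<open>v = \<rho> * r > 0\<close> and the angles \<open>\<phi>\<close> and \<open>\<theta>\<close>.\<close>

definition dihedral_series :: "nat \<Rightarrow> real \<Rightarrow> real \<Rightarrow> real \<Rightarrow> real \<Rightarrow> real" where
  "dihedral_series n k v \<phi> \<theta> =
     1 / Beta (k + 1/2) (1/2) * (2 / v) powr (real n * k) *
     (\<Sum>j. bessel_I (real n * real j + real n * k) v * (real j + k) *
        (gegenbauer j k (cos (real n * \<phi>)) * gegenbauer j k (cos (real n * \<theta>))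
         / gegenbauer j k 1))"

text \<open>If \<open>x = 0\<close> or \<open>y = 0\<close>, the factor $(2/(\rho r))^{nk}$ is singular and the value is the
  one obtained by continuous extension, i.e. for \<open>v\<close> tending to \<open>0\<close> from the right
  (the limit does not depend on the angles).\<close>

definition dihedral_bessel_unnormalized :: "nat \<Rightarrow> real \<Rightarrow> complex \<Rightarrow> complex \<Rightarrow> real" where
  "dihedral_bessel_unnormalized n k x y =
     (if x = 0 \<or> y = 0
      then Lim (at_right 0) (\<lambda>v. dihedral_series n k v (Arg x) (Arg y))
      else dihedral_series n k (norm x * norm y) (Arg x) (Arg y))"

text \<open>The normalizing constant $c_{n,k}$, characterized by $D_k(0,y) = 1$ on the closed
  wedge.\<close>

definition dihedral_const :: "nat \<Rightarrow> real \<Rightarrow> real" where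
  "dihedral_const n k =
     (THE c. \<forall>y \<in> closure (dihedral_wedge n). c * dihedral_bessel_unnormalized n k 0 y = 1)"

text \<open>At \<open>k = 0\<close> the Gegenbauer form is degenerate ($C_j^{(0)} = 0$ for \<open>j \<ge> 1\<close>, and
  $c_{n,k}$ is unbounded as $k \to 0$), and is understood, as usual, as the limit for \<open>k\<close>
  tending to \<open>0\<close> from the right.\<close>

definition dihedral_bessel :: "nat \<Rightarrow> real \<Rightarrow> complex \<Rightarrow> complex \<Rightarrow> real" where
  "dihedral_bessel n k x y =
     (if k = 0
      then Lim (at_right 0) (\<lambda>\<kappa>. dihedral_const n \<kappa> * dihedral_bessel_unnormalized n \<kappa> x y)
      else dihedral_const n k * dihedral_bessel_unnormalized n k x y)"

end

theory Submission
  imports Defs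
begin

text \<open>
  Write \<open>a = n * \<theta>\<close>, \<open>b = n * \<phi>\<close> and \<open>v = \<rho> * r\<close>. The normalizing constant is
  \<open>n * Beta (k + 1/2) (1/2) * Gamma (n * k)\<close>, so the prefactor on the right-hand side equals \<open>1\<close>,
  and the identity is one between power series in \<open>v\<close>. It suffices to compare their formal Laplace
  transforms in \<open>w\<close>, obtained by multiplying the coefficient of \<open>v ^ N\<close> by \<open>pochhammer (n * k) N\<close>,
  for small \<open>w = 2 * u / (1 + u\<^sup>2)\<close>. The Bessel functions become powers of \<open>u\<close>, by the generalized
  Catalan generating function, and the left-hand side becomes \<open>(1 + u\<^sup>2) powr (n * k)\<close> times the
  Poisson kernel of the Gegenbauer polynomials at \<open>q = u ^ n\<close>. The Horn functions become powers of
  the product of the factors \<open>1 - w * cos (\<theta> - \<phi> + 2 * pi * s / n)\<close>, which is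
  \<open>(1 - 2 * q * cos (a - b) + q\<^sup>2) / (1 + u\<^sup>2) ^ n\<close>. The two sides then agree by Gegenbauer's product
  formula, whose right-hand side solves the same singular differential equation in \<open>a\<close> as the
  left-hand side. Dominated convergence gives the limit \<open>k\<close> to \<open>0\<close>.
\<close>

text \<open>The substitution for w is chosen because 1 - w cos x becomes (1 - 2 u cos x + u^2) / (1
  + u^2). The numerators at n equally spaced angles multiply to an expression of the same shape in q
  = u^n, which is the denominator of the Gegenbauer generating function. It also rationalizes the
  square root in the Catalan series. Only small w has to be considered, although v is arbitrary: the
  weights v^N / (n k)_N decay faster than any geometric sequence, so absolute summability of the
  transforms at one positive radius carries over to the original series. The obstacle in the product
  formula is that its differential equation degenerates at a = 0. A monotone energy replaces the
  usual uniqueness theorem. Estimates are crude on purpose. The recurrence directly gives |C_j| <=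
  3^j C_j(1) on [-1, 1]; products of two values then grow like 9^j, so the generating variable has
  to stay below 1/9, and 1/12 is used throughout.\<close>

section \<open>Contiguous relations for Gegenbauer polynomials\<close>

text \<open>Extending the Gegenbauer polynomials by zero to negative degrees makes the recurrences valid
  for all integers, without boundary cases.\<close>

definition geg :: "int \<Rightarrow> real \<Rightarrow> real \<Rightarrow> real" where
  "geg m k t = (if m < 0 then 0 else gegenbauer (nat m) k t)"

lemma geg_neg [simp]: "m < 0 \<Longrightarrow> geg m k t = 0"
  by (simp add: geg_def)

lemma geg_of_nat [simp]: "geg (int j) k t = gegenbauer j k t"
  by (simp add: geg_def)

lemma geg_0 [simp]: "geg 0 k t = 1"
  by (simp add: geg_def)

lemma geg_rec:
  "of_int m * geg m k t =
     2 * (of_int m - 1 + k) * t * geg (m - 1) k t - (of_int m - 2 + 2 * k) * geg (m - 2) k t"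
proof -
  have "m < 0 \<or> m = 0 \<or> m = 1 \<or> m = int (nat (m - 2)) + 2"
    by arith
  then consider "m < 0" | "m = 0" | "m = 1" | j where "m = int j + 2"
    by blast
  then show ?thesis
  proof cases
    case (4 j)
    have "nat m = Suc (Suc j)" "nat (m - 1) = Suc j" "nat (m - 2) = j"
      using 4 by auto
    moreover have "(real j + 2) * gegenbauer (Suc (Suc j)) k t =
        2 * (real j + 1 + k) * t * gegenbauer (Suc j) k t - (real j + 2 * k) * gegenbauer j k t"
      by simp
    ultimately show ?thesis
      using 4 by (simp add: geg_def del: gegenbauer.simps)
  qed (auto simp: geg_def)
qed

text \<open>The recurrence determines \<open>A m\<close> from lower degrees except at
  \<open>m = 0\<close>, where its left side vanishes; hence the separate initial value. Identities
  can then be proved by checking that a candidate obeys the recurrence.\<close>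

lemma geg_unique:
  assumes "A 0 = 1" "\<And>m. m < 0 \<Longrightarrow> A m = 0"
    and "\<And>m. of_int m * A m =
      2 * (of_int m - 1 + k) * t * A (m - 1) - (of_int m - 2 + 2 * k) * A (m - 2)"
  shows "A m = geg m k t"
proof (induction "nat m" arbitrary: m rule: less_induct)
  case less
  show ?case
  proof (cases "m \<le> 0")
    case False
    have "A (m - 1) = geg (m - 1) k t"
      by (rule less) (use False in auto)
    moreover have "A (m - 2) = geg (m - 2) k t"
      by (rule less) (use False in auto)
    ultimately have "of_int m * A m = of_int m * geg m k t"
      by (simp add: assms(3) geg_rec)
    then show ?thesis
      using False by simp
  qed (use assms in \<open>cases "m = 0"; simp\<close>)
qed

lemma geg_contiguous_aux:
  "of_int m * (geg m (k + 1) t - 2 * t * geg (m - 1) (k + 1) t + geg (m - 2) (k + 1) t) =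
     2 * k * (t * geg (m - 1) (k + 1) t - geg (m - 2) (k + 1) t)"
proof -
  have "of_int m * geg m (k + 1) t = 2 * (of_int m + k) * t * geg (m - 1) (k + 1) t
      - (of_int m + 2 * k) * geg (m - 2) (k + 1) t"
    using geg_rec[of m "k + 1" t] by simp
  then show ?thesis
    by (simp add: algebra_simps)
qed

text \<open>With W = 1 - 2 t q + q^2, this is the coefficient of q^m in W^(-k) = W * W^(-k-1). The
  proof uses only recurrences: the right-hand side satisfies the one for parameter k.\<close>

lemma geg_contiguous:
  "geg m k t = geg m (k + 1) t - 2 * t * geg (m - 1) (k + 1) t + geg (m - 2) (k + 1) t"
proof -
  define C where "C = (\<lambda>m. geg m (k + 1) t)"
  define A where "A m = C m - 2 * t * C (m - 1) + C (m - 2)" for m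
  have *: "of_int m * A m = 2 * k * (t * C (m - 1) - C (m - 2))" for m
    unfolding A_def C_def by (rule geg_contiguous_aux)
  have "A m = geg m k t"
  proof (rule geg_unique)
    fix m
    have "(of_int m - 1) * A (m - 1) = 2 * k * (t * C (m - 2) - C (m - 3))"
      using *[of "m - 1"] by simp
    moreover have "(of_int m - 2) * A (m - 2) = 2 * k * (t * C (m - 3) - C (m - 4))"
      using *[of "m - 2"] by simp
    moreover have "A (m - 1) = C (m - 1) - 2 * t * C (m - 2) + C (m - 3)"
      "A (m - 2) = C (m - 2) - 2 * t * C (m - 3) + C (m - 4)"
      by (simp_all add: A_def)
    ultimately show "of_int m * A m =
        2 * (of_int m - 1 + k) * t * A (m - 1) - (of_int m - 2 + 2 * k) * A (m - 2)"
      unfolding * by algebra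
  qed (simp_all add: A_def C_def)
  then show ?thesis
    by (simp add: A_def C_def)
qed

text \<open>Coefficientwise this is q d/dq applied to W^(-k), where W = 1 - 2 t q + q^2: the result
  is 2 k (t q - q^2) W^(-k-1).\<close>

lemma geg_degree:
  "of_int m * geg m k t = 2 * k * (t * geg (m - 1) (k + 1) t - geg (m - 2) (k + 1) t)"
  using geg_contiguous_aux geg_contiguous by metis

text \<open>The Gegenbauer differential equation with both derivatives already replaced by
  polynomials of shifted parameter, which makes it an algebraic consequence of the contiguous
  relations.\<close>

lemma geg_ode:
  "4 * k * (k + 1) * (1 - t\<^sup>2) * geg (m - 2) (k + 2) t - (2 * k + 1) * (2 * k) * t * geg (m - 1) (k + 1) t
     + of_int m * (of_int m + 2 * k) * geg m k t = 0"
proof -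
  define C where "C = (\<lambda>m. geg m (k + 2) t)"
  define A where "A = (\<lambda>m. geg m (k + 1) t)"
  define B where "B = geg m k t"
  have 1: "of_int m * B = 2 * k * (t * A (m - 1) - A (m - 2))"
    unfolding A_def B_def by (rule geg_degree)
  have 2: "(of_int m - 1) * A (m - 1) = 2 * (k + 1) * (t * C (m - 2) - C (m - 3))"
    using geg_degree[of "m - 1" "k + 1" t] by (simp add: A_def C_def add.assoc)
  have 3: "(of_int m - 2) * A (m - 2) = 2 * (k + 1) * (t * C (m - 3) - C (m - 4))"
    using geg_degree[of "m - 2" "k + 1" t] by (simp add: A_def C_def add.assoc)
  have 4: "A (m - 2) = C (m - 2) - 2 * t * C (m - 3) + C (m - 4)"
    using geg_contiguous[of "m - 2" "k + 1" t] by (simp add: A_def C_def add.assoc)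
  have "4 * k * (k + 1) * (1 - t\<^sup>2) * C (m - 2) - (2 * k + 1) * (2 * k) * t * A (m - 1)
     + of_int m * (of_int m + 2 * k) * B = 0"
    using 1 2 3 4 by algebra
  then show ?thesis
    by (simp add: A_def B_def C_def)
qed

lemma geg_has_field_derivative:
  "(geg m k has_field_derivative 2 * k * geg (m - 1) (k + 1) t) (at t within S)"
proof (induction "nat m" arbitrary: m rule: less_induct)
  case less
  show ?case
  proof (cases "m \<le> 0")
    case True
    then have "geg m k = (\<lambda>t. if m < 0 then 0 else 1)"
      by (auto simp: geg_def fun_eq_iff)
    then show ?thesis
      using True by simp
  next
    case False
    have D1: "(geg (m - 1) k has_field_derivative 2 * k * geg (m - 2) (k + 1) t) (at t within S)"
      using less[of "m - 1"] False by simp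
    have D2: "(geg (m - 2) k has_field_derivative 2 * k * geg (m - 3) (k + 1) t) (at t within S)"
      using less[of "m - 2"] False by simp
    define C where "C = (\<lambda>m. geg m (k + 1) t)"
    define A where "A = geg (m - 1) k t"
    have eq: "geg m k = (\<lambda>t. (2 * (of_int m - 1 + k) * t * geg (m - 1) k t
        - (of_int m - 2 + 2 * k) * geg (m - 2) k t) / of_int m)"
      using geg_rec[of m k] False by (auto simp: field_simps fun_eq_iff)
    have 1: "(of_int m - 1) * A = 2 * k * (t * C (m - 2) - C (m - 3))"
      using geg_degree[of "m - 1" k t] by (simp add: A_def C_def)
    have 2: "A = C (m - 1) - 2 * t * C (m - 2) + C (m - 3)"
      using geg_contiguous[of "m - 1" k t] by (simp add: A_def C_def)
    have 3: "(of_int m - 1) * C (m - 1) =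
        2 * (of_int m - 1 + k) * t * C (m - 2) - (of_int m - 1 + 2 * k) * C (m - 3)"
      using geg_rec[of "m - 1" "k + 1" t] by (simp add: C_def algebra_simps)
    have "2 * (of_int m - 1 + k) * (A + t * (2 * k * C (m - 2)))
        - (of_int m - 2 + 2 * k) * (2 * k * C (m - 3)) = of_int m * (2 * k * C (m - 1))"
      using 1 2 3 by algebra
    moreover have "(geg m k has_field_derivative
        (2 * (of_int m - 1 + k) * (A + t * (2 * k * C (m - 2)))
        - (of_int m - 2 + 2 * k) * (2 * k * C (m - 3))) / of_int m) (at t within S)"
      unfolding eq A_def C_def
    proof (rule DERIV_cdivide)
      have "((\<lambda>t. 2 * (of_int m - 1 + k) * t) has_field_derivative 2 * (of_int m - 1 + k))
          (at t within S)"
        by (rule DERIV_cmult_Id)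
      from DERIV_diff[OF DERIV_mult[OF this D1] DERIV_cmult[OF D2, of "of_int m - 2 + 2 * k"]]
      show "((\<lambda>t. 2 * (of_int m - 1 + k) * t * geg (m - 1) k t
          - (of_int m - 2 + 2 * k) * geg (m - 2) k t) has_field_derivative
          2 * (of_int m - 1 + k) * (geg (m - 1) k t + t * (2 * k * geg (m - 2) (k + 1) t))
          - (of_int m - 2 + 2 * k) * (2 * k * geg (m - 3) (k + 1) t)) (at t within S)"
        by (rule DERIV_cong) (simp add: algebra_simps)
    qed
    ultimately show ?thesis
      using False by (simp add: C_def)
  qed
qed

text \<open>The factor \<open>3 ^ j\<close> on top of \<open>gegenbauer j k 1\<close> lets the
  recurrence be estimated with absolute values; the price is the radius 1/3 in the generating
  function.\<close>

lemma abs_gegenbauer_le: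
  assumes "0 < k" "\<bar>t\<bar> \<le> 1"
  shows "\<bar>gegenbauer j k t\<bar> \<le> 3 ^ j * pochhammer (2 * k) j / fact j"
  using assms
proof (induction j k t rule: gegenbauer.induct)
  case (2 k t)
  then show ?case
    by (simp add: abs_mult)
next
  case (3 j k t)
  define E where "E i = 3 ^ i * pochhammer (2 * k) i / fact i" for i
  have E_pos: "0 \<le> E i" for i
    using \<open>0 < k\<close> by (simp add: E_def pochhammer_nonneg)
  have step: "(real i + 1) * E (Suc i) = 3 * (2 * k + real i) * E i" for i
    by (simp add: E_def pochhammer_Suc divide_simps)
  \<comment> \<open>Split 3 (2 k + j + 1) into 2 (j + 1 + k), which matches the leading term of the
    recurrence, and j + 1 + 4 k, which has to absorb the term with \<open>E j\<close>.\<close>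
  have "(real j + 2 * k) * E j * (real j + 1) \<le> (real j + 2 * k) * E j * (3 * (real j + 1 + 4 * k))"
    using 3 E_pos[of j] by (intro mult_left_mono mult_nonneg_nonneg) simp_all
  also have "\<dots> = (real j + 1 + 4 * k) * ((real j + 1) * E (Suc j))"
    unfolding step by (simp add: algebra_simps)
  also have "\<dots> = (real j + 1 + 4 * k) * E (Suc j) * (real j + 1)"
    by (simp only: ac_simps)
  finally have "(real j + 2 * k) * E j \<le> (real j + 1 + 4 * k) * E (Suc j)"
    by (rule mult_right_le_imp_le) simp
  moreover have "(real j + 2) * E (Suc (Suc j)) = 3 * (2 * k + real j + 1) * E (Suc j)"
    using step[of "Suc j"] by (simp add: algebra_simps)
  ultimately have le: "2 * (real j + 1 + k) * E (Suc j) + (real j + 2 * k) * E j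
      \<le> (real j + 2) * E (Suc (Suc j))"
    by (simp add: algebra_simps)
  have "\<bar>2 * (real j + 1 + k) * t * gegenbauer (Suc j) k t - (real j + 2 * k) * gegenbauer j k t\<bar>
     \<le> \<bar>2 * (real j + 1 + k) * (t * gegenbauer (Suc j) k t)\<bar> + \<bar>(real j + 2 * k) * gegenbauer j k t\<bar>"
    by (metis abs_triangle_ineq4 mult.assoc)
  also have "\<dots> = 2 * (real j + 1 + k) * (\<bar>t\<bar> * \<bar>gegenbauer (Suc j) k t\<bar>)
      + (real j + 2 * k) * \<bar>gegenbauer j k t\<bar>"
    using 3 by (simp add: abs_mult)
  also have "\<dots> \<le> 2 * (real j + 1 + k) * E (Suc j) + (real j + 2 * k) * E j"
  proof (rule add_mono; rule mult_left_mono)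
    have "\<bar>t\<bar> * \<bar>gegenbauer (Suc j) k t\<bar> \<le> 1 * E (Suc j)"
      by (rule mult_mono) (use 3 in \<open>simp_all add: E_def\<close>)
    then show "\<bar>t\<bar> * \<bar>gegenbauer (Suc j) k t\<bar> \<le> E (Suc j)"
      by simp
  qed (use 3 in \<open>simp_all add: E_def\<close>)
  also have "\<dots> \<le> (real j + 2) * E (Suc (Suc j))"
    using le by simp
  finally show ?case
    by (simp only: gegenbauer.simps flip: E_def) (simp add: abs_divide pos_divide_le_eq mult.commute)
qed simp

lemma gegenbauer_minus: "gegenbauer j k (- t) = (-1) ^ j * gegenbauer j k t"
proof (induction j k t rule: gegenbauer.induct)
  case (3 j k t)
  have *: "(a * (- t) * (- p * x) - b * (p * y)) / d = p * ((a * t * x - b * y) / d)"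
    for a b p x y d :: real
    by (simp add: right_diff_distrib diff_divide_distrib mult_ac)
  have "gegenbauer (Suc (Suc j)) k (- t) =
      (2 * (real j + 1 + k) * (- t) * (- ((-1) ^ j) * gegenbauer (Suc j) k t)
        - (real j + 2 * k) * ((-1) ^ j * gegenbauer j k t)) / (real j + 2)"
    using 3 by simp
  also have "\<dots> = (-1) ^ j * gegenbauer (Suc (Suc j)) k t"
    unfolding * by simp
  finally show ?case
    by simp
qed simp_all

section \<open>The product formula\<close>

text \<open>The coefficient of U'' vanishes at 0, so standard uniqueness for initial values does not
  apply. The equation gives E' = -4 k cot(x) U'^2 for the energy E, and the cotangent is nonnegative
  up to pi / 2.\<close>

lemma dihedral_energy_zero:
  fixes U U' U'' :: "real \<Rightarrow> real"
  assumes U: "\<And>a. (U has_real_derivative U' a) (at a)"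
    and U': "\<And>a. (U' has_real_derivative U'' a) (at a)"
    and ode: "\<And>a. (sin a)\<^sup>2 * U'' a + 2 * k * sin a * cos a * U' a + \<mu> * (sin a)\<^sup>2 * U a = 0"
    and "U 0 = 0" "U' 0 = 0" "0 < \<mu>" "0 \<le> k" "0 \<le> a" "a \<le> pi / 2"
  shows "U a = 0"
proof -
  define E where "E a = (U' a)\<^sup>2 + \<mu> * (U a)\<^sup>2" for a
  have "E a \<le> E 0"
  proof (rule DERIV_nonpos_imp_nonincreasing[OF \<open>0 \<le> a\<close>])
    fix x assume x: "0 \<le> x" "x \<le> a"
    have "(E has_real_derivative 2 * U' x * (U'' x + \<mu> * U x)) (at x)"
      unfolding E_def by (auto intro!: derivative_eq_intros U U' simp: algebra_simps)
    moreover have "2 * U' x * (U'' x + \<mu> * U x) \<le> 0"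
    proof (cases "x = 0")
      case False
      then have s: "0 < sin x"
        using x \<open>a \<le> pi / 2\<close> pi_gt_zero by (intro sin_gt_zero) linarith+
      have c: "0 \<le> cos x"
        using x \<open>a \<le> pi / 2\<close> by (intro cos_ge_zero) linarith+
      have "sin x * (sin x * (U'' x + \<mu> * U x)) = sin x * (- 2 * k * cos x * U' x)"
        using ode[of x] by (simp add: algebra_simps power2_eq_square)
      then have "sin x * (U'' x + \<mu> * U x) = - 2 * k * cos x * U' x"
        using s by (metis mult_cancel_left less_irrefl)
      then have "sin x * (2 * U' x * (U'' x + \<mu> * U x)) = - (4 * k * cos x * (U' x)\<^sup>2)"
        by algebra
      also have "\<dots> \<le> 0"
        using c \<open>0 \<le> k\<close> by simp
      finally show ?thesis
        using s by (simp add: mult_le_0_iff)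
    qed (use \<open>U' 0 = 0\<close> in simp)
    ultimately show "\<exists>y. (E has_real_derivative y) (at x) \<and> y \<le> 0"
      by blast
  qed
  also have "E 0 = 0"
    using \<open>U 0 = 0\<close> \<open>U' 0 = 0\<close> by (simp add: E_def)
  finally have "\<mu> * (U a)\<^sup>2 \<le> 0"
    unfolding E_def using zero_le_power2[of "U' a"] by linarith
  then show ?thesis
    using \<open>0 < \<mu>\<close> by (simp add: mult_le_0_iff)
qed

text \<open>The \<open>j\<close>-th derivative of \<open>gegenbauer N k\<close> in closed form; for
  \<open>j > N\<close> the degree of \<open>geg\<close> is negative and the value is 0, as it should
  be.\<close>

definition gegenbauer_diff :: "nat \<Rightarrow> real \<Rightarrow> nat \<Rightarrow> real \<Rightarrow> real" where
  "gegenbauer_diff N k j t = 2 ^ j * pochhammer k j * geg (int N - int j) (k + real j) t"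

lemma gegenbauer_diff_has_derivative:
  "(gegenbauer_diff N k j has_real_derivative gegenbauer_diff N k (Suc j) t) (at t)"
proof -
  have "(gegenbauer_diff N k j has_real_derivative 2 ^ j * pochhammer k j *
      (2 * (k + real j) * geg (int N - int j - 1) (k + real j + 1) t)) (at t)"
    unfolding gegenbauer_diff_def by (rule DERIV_cmult geg_has_field_derivative)+
  then show ?thesis
    by (simp add: gegenbauer_diff_def pochhammer_Suc algebra_simps)
qed

lemma gegenbauer_diff_0: "gegenbauer_diff N k 0 t = gegenbauer N k t"
  by (simp add: gegenbauer_diff_def)

lemma gegenbauer_diff_beyond: "N < j \<Longrightarrow> gegenbauer_diff N k j t = 0"
  by (simp add: gegenbauer_diff_def)

text \<open>The \<open>j\<close>-th derivative solves the Gegenbauer equation of degree N - j and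
  parameter k + j, with eigenvalue (N - j) (N - j + 2 (k + j)).\<close>

lemma gegenbauer_diff_ode:
  "(1 - t\<^sup>2) * gegenbauer_diff N k (Suc (Suc j)) t =
     (2 * k + 1 + 2 * real j) * t * gegenbauer_diff N k (Suc j) t
     - (real N - real j) * (real N + 2 * k + real j) * gegenbauer_diff N k j t"
proof -
  define c where "c = 2 ^ j * pochhammer k j"
  define G where "G i = geg (int N - int j - i) (k + real j + of_int i) t" for i
  have "4 * (k + real j) * (k + real j + 1) * (1 - t\<^sup>2) * G 2
      - (2 * (k + real j) + 1) * (2 * (k + real j)) * t * G 1
      + (real N - real j) * (real N - real j + 2 * (k + real j)) * G 0 = 0"
    using geg_ode[of "k + real j" t "int N - int j"] by (simp add: G_def add.assoc)
  moreover have "gegenbauer_diff N k j t = c * G 0"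
    "gegenbauer_diff N k (Suc j) t = c * (2 * (k + real j)) * G 1"
    "gegenbauer_diff N k (Suc (Suc j)) t = c * (4 * (k + real j) * (k + real j + 1)) * G 2"
    by (simp_all add: gegenbauer_diff_def c_def G_def pochhammer_Suc algebra_simps)
  ultimately show ?thesis
    by algebra
qed

text \<open>(k)_j / (2k)_j is the j-th moment of the Beta distribution with both parameters k; 1 /
  j! comes from Taylor's formula.\<close>

definition product_weight :: "real \<Rightarrow> nat \<Rightarrow> real" where
  "product_weight k j = pochhammer k j / (pochhammer (2 * k) j * fact j)"

lemma product_weight_0 [simp]: "product_weight k 0 = 1"
  by (simp add: product_weight_def)

lemma product_weight_Suc:
  assumes "0 < k"
  shows "(real j + 1) * (real j + 2 * k) * product_weight k (Suc j) = (k + real j) * product_weight k j"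
proof -
  have "pochhammer (2 * k) j \<noteq> 0"
    using pochhammer_pos[of "2 * k" j] assms by simp
  moreover have "2 * k + real j \<noteq> 0"
    using assms by linarith
  ultimately show ?thesis
    by (simp add: product_weight_def pochhammer_Suc divide_simps) (simp add: algebra_simps)
qed

text \<open>The right-hand side is a Taylor expansion of the expectation of
  \<open>C_N (cos (a - b) - 2 * \<xi> * sin a * sin b)\<close>, where \<open>\<xi>\<close> has the Beta distribution with
  both parameters equal to \<open>k\<close>. It solves the Gegenbauer equation in the variable \<open>a\<close>.\<close>

lemma gegenbauer_product_quadrant:
  assumes "0 < k" "0 \<le> a" "a \<le> pi / 2"
  shows "gegenbauer N k (cos a) * gegenbauer N k (cos b) / gegenbauer N k 1 =
    (\<Sum>j\<le>N. product_weight k j * (- 2 * sin a * sin b) ^ j * gegenbauer_diff N k j (cos (a - b)))"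
\<comment> \<open>The energy argument needs a positive eigenvalue \<mu>, so degree 0 is treated
  apart.\<close>
proof (cases "N = 0")
  case False
  define w where "w = product_weight k"
  define P where "P = gegenbauer_diff N k"
  define \<mu> where "\<mu> = real N * (real N + 2 * k)"
  define C where "C = gegenbauer N k (cos b) / gegenbauer N k 1"
  define \<sigma> where "\<sigma> a = - 2 * sin a * sin b" for a
  define \<sigma>' where "\<sigma>' a = - 2 * cos a * sin b" for a
  define y where "y a = cos (a - b)" for a
  define y' where "y' a = - sin (a - b)" for a
  define T where "T j a = w j * (\<sigma> a ^ j * P j (y a))" for j a
  define T1 where "T1 j a = w j * (real j * \<sigma> a ^ (j - 1) * \<sigma>' a * P j (y a)
      + \<sigma> a ^ j * y' a * P (Suc j) (y a))" for j a
  define T2 where "T2 j a = w j * (real j * (real (j - 1) * \<sigma> a ^ (j - 2) * \<sigma>' a) * \<sigma>' a * P j (y a)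
      - real j * \<sigma> a ^ (j - 1) * \<sigma> a * P j (y a)
      + 2 * real j * \<sigma> a ^ (j - 1) * \<sigma>' a * y' a * P (Suc j) (y a)
      + \<sigma> a ^ j * ((y' a)\<^sup>2 * P (Suc (Suc j)) (y a) - y a * P (Suc j) (y a)))" for j a
  define Z where "Z a = C * P 0 (cos a)" for a
  define Z1 where "Z1 a = C * (- sin a * P 1 (cos a))" for a
  define Z2 where "Z2 a = C * (- cos a * P 1 (cos a) + (sin a)\<^sup>2 * P 2 (cos a))" for a
  have P: "(P j has_real_derivative P (Suc j) t) (at t)" for j t
    unfolding P_def by (rule gegenbauer_diff_has_derivative)
  note [derivative_intros] = DERIV_chain2[OF P]
  have [derivative_intros]: "(\<sigma> has_real_derivative \<sigma>' a) (at a)"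
    "(\<sigma>' has_real_derivative - \<sigma> a) (at a)" "(y has_real_derivative y' a) (at a)"
    "(y' has_real_derivative - y a) (at a)" for a
    unfolding \<sigma>_def \<sigma>'_def y_def y'_def by (auto intro!: derivative_eq_intros)
  have P_ode: "(1 - t\<^sup>2) * P (Suc (Suc j)) t =
     (2 * k + 1 + 2 * real j) * t * P (Suc j) t - (real N - real j) * (real N + 2 * k + real j) * P j t"
    for j t
    unfolding P_def by (rule gegenbauer_diff_ode)
  have T: "(T j has_real_derivative T1 j a) (at a)" for j a
    unfolding T_def T1_def by (auto intro!: derivative_eq_intros simp: algebra_simps)
  have T1: "(T1 j has_real_derivative T2 j a) (at a)" for j a
    unfolding T1_def T2_def
    by (auto intro!: derivative_eq_intros simp: algebra_simps power2_eq_square numeral_2_eq_2)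
  have Z: "(Z has_real_derivative Z1 a) (at a)" "(Z1 has_real_derivative Z2 a) (at a)" for a
    unfolding Z_def Z1_def Z2_def
    by (auto intro!: derivative_eq_intros simp: algebra_simps power2_eq_square numeral_2_eq_2)
  \<comment> \<open>The Gegenbauer operator in \<open>a\<close> maps the \<open>j\<close>-th term to
    a difference of consecutive \<open>e\<close>. The factor \<open>j\<close> kills
    \<open>e 0\<close>, and the derivative of order N + 1 kills \<open>e (Suc N)\<close>.\<close>
  define e where "e j a = real j * (real j + 2 * k - 1) * w j * \<sigma> a ^ j * P j (y a)" for j a
  have telescope: "(sin a)\<^sup>2 * T2 j a + 2 * k * sin a * cos a * T1 j a + \<mu> * (sin a)\<^sup>2 * T j a
      = e j a - e (Suc j) a" for j a
  proof -
    define X where "X = \<sigma> a ^ j"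
    define X1 where "X1 = real j * \<sigma> a ^ (j - 1)"
    define X2 where "X2 = real j * (real (j - 1) * \<sigma> a ^ (j - 2))"
    define s c where "s = sin a" and "c = cos a"
    define Pj Pj1 Pj2 where "Pj = P j (y a)" and "Pj1 = P (Suc j) (y a)" and "Pj2 = P (Suc (Suc j)) (y a)"
    \<comment> \<open>Multiplication by powers of \<open>\<sigma> a\<close> undoes the truncated
      subtractions \<open>j - 1\<close> and \<open>j - 2\<close>, so j = 0 and j = 1 need no
      separate treatment below.\<close>
    have X1: "X1 * \<sigma> a = real j * X"
      unfolding X_def X1_def by (cases j) auto
    have X2: "X2 * (\<sigma> a)\<^sup>2 = real j * (real j - 1) * X"
    proof (cases j)
      case (Suc i)
      then show ?thesis
        unfolding X_def X2_def by (cases i) (auto simp: power2_eq_square)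
    qed (simp add: X2_def)
    have s\<sigma>: "s * \<sigma>' a = c * \<sigma> a"
      by (simp add: s_def c_def \<sigma>_def \<sigma>'_def)
    have sc: "s\<^sup>2 + c\<^sup>2 = 1" "(y' a)\<^sup>2 = 1 - (y a)\<^sup>2"
      by (simp_all add: s_def c_def y_def y'_def sin_squared_eq)
    \<comment> \<open>Expanding sin b with b = a - (a - b) expresses \<open>\<sigma> a\<close>
      through \<open>y\<close> and \<open>y'\<close>; the terms with \<open>Pj1\<close> then combine
      into one multiple of \<open>\<sigma> a\<close>.\<close>
    have B: "c * y' a + s * y a = sin b"
      using sin_diff[of a "a - b"] by (simp add: s_def c_def y_def y'_def)
    have "\<sigma> a = - 2 * s * (c * y' a + s * y a)"
      unfolding B by (simp add: \<sigma>_def s_def)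
    note \<sigma>_eq = this
    have wS: "(real j + 1) * (real j + 2 * k) * w (Suc j) = (k + real j) * w j"
      unfolding w_def by (rule product_weight_Suc[OF \<open>0 < k\<close>])
    have ode: "(1 - (y a)\<^sup>2) * Pj2 = (2 * k + 1 + 2 * real j) * y a * Pj1
        - (real N - real j) * (real N + 2 * k + real j) * Pj"
      unfolding Pj_def Pj1_def Pj2_def by (rule P_ode)
    have T_eqs: "T j a = w j * (X * Pj)" "T1 j a = w j * (X1 * \<sigma>' a * Pj + X * y' a * Pj1)"
      "T2 j a = w j * (X2 * (\<sigma>' a)\<^sup>2 * Pj - X1 * \<sigma> a * Pj + 2 * X1 * \<sigma>' a * y' a * Pj1
        + X * ((y' a)\<^sup>2 * Pj2 - y a * Pj1))"
      by (simp_all add: T_def T1_def T2_def X_def X1_def X2_def Pj_def Pj1_def Pj2_def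
          power2_eq_square mult.assoc)
    have sX1: "s * (X1 * \<sigma>' a) = real j * c * X"
      using X1 s\<sigma> by algebra
    have sX2: "s\<^sup>2 * (X2 * (\<sigma>' a)\<^sup>2) = real j * (real j - 1) * c\<^sup>2 * X"
      using X2 s\<sigma> by algebra
    have "s\<^sup>2 * T2 j a + 2 * k * s * c * T1 j a + \<mu> * s\<^sup>2 * T j a =
       w j * (s\<^sup>2 * (X2 * (\<sigma>' a)\<^sup>2) * Pj - s\<^sup>2 * (X1 * \<sigma> a) * Pj + 2 * s * (s * (X1 * \<sigma>' a)) * y' a * Pj1
        + s\<^sup>2 * X * ((y' a)\<^sup>2 * Pj2 - y a * Pj1)
        + 2 * k * c * (s * (X1 * \<sigma>' a) * Pj + s * X * y' a * Pj1) + \<mu> * s\<^sup>2 * (X * Pj))"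
      unfolding T_eqs by (simp add: algebra_simps power2_eq_square)
    also have "\<dots> = w j * X * (real j * (real j - 1) * c\<^sup>2 * Pj - s\<^sup>2 * real j * Pj
        + 2 * s * (real j * c) * y' a * Pj1
        + s\<^sup>2 * ((1 - (y a)\<^sup>2) * Pj2 - y a * Pj1)
        + 2 * k * c * (real j * c * Pj + s * y' a * Pj1) + \<mu> * s\<^sup>2 * Pj)"
      unfolding sX1 sX2 X1 sc by (simp add: algebra_simps)
    also have "\<dots> = w j * X * (real j * (real j + 2 * k - 1) * (s\<^sup>2 + c\<^sup>2) * Pj
        + 2 * (k + real j) * (s * (c * y' a + s * y a)) * Pj1)"
      unfolding ode \<mu>_def by (simp add: algebra_simps power2_eq_square)
    also have "\<dots> = real j * (real j + 2 * k - 1) * w j * X * Pj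
        - ((k + real j) * w j) * (\<sigma> a * X) * Pj1"
      unfolding sc \<sigma>_eq by (simp add: algebra_simps)
    also have "\<dots> = e j a - e (Suc j) a"
      unfolding wS[symmetric] by (simp add: e_def X_def Pj_def Pj1_def mult_ac add_ac)
    finally show ?thesis
      by (simp add: s_def c_def)
  qed
  define U where "U a = (\<Sum>j\<le>N. T j a) - Z a" for a
  define U1 where "U1 a = (\<Sum>j\<le>N. T1 j a) - Z1 a" for a
  define U2 where "U2 a = (\<Sum>j\<le>N. T2 j a) - Z2 a" for a
  have "U a = 0"
  proof (rule dihedral_energy_zero[where U = U and a = a and U' = U1 and U'' = U2 and k = k and \<mu> = \<mu>])
    show "(U has_real_derivative U1 a) (at a)" "(U1 has_real_derivative U2 a) (at a)" for a
      unfolding U_def U1_def U2_def by (intro DERIV_diff DERIV_sum T T1 Z)+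
    show "(sin a)\<^sup>2 * U2 a + 2 * k * sin a * cos a * U1 a + \<mu> * (sin a)\<^sup>2 * U a = 0" for a
    proof -
      have ode: "(sin a)\<^sup>2 * P 2 (cos a) = (2 * k + 1) * cos a * P 1 (cos a) - \<mu> * P 0 (cos a)"
        using P_ode[of "cos a" 0] sin_squared_eq[of a] by (simp add: \<mu>_def numeral_2_eq_2)
      have "(sin a)\<^sup>2 * Z2 a + 2 * k * sin a * cos a * Z1 a + \<mu> * (sin a)\<^sup>2 * Z a = 0"
        unfolding Z2_def Z1_def Z_def ode by (simp add: algebra_simps power2_eq_square)
      moreover have "(sin a)\<^sup>2 * (\<Sum>j\<le>N. T2 j a) + 2 * k * sin a * cos a * (\<Sum>j\<le>N. T1 j a)
          + \<mu> * (sin a)\<^sup>2 * (\<Sum>j\<le>N. T j a) = (\<Sum>j\<le>N. e j a - e (Suc j) a)"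
        unfolding telescope[symmetric] by (simp add: sum.distrib sum_distrib_left)
      moreover have "(\<Sum>j\<le>N. e j a - e (Suc j) a) = e 0 a - e (Suc N) a"
        by (rule sum_telescope)
      moreover have "e 0 a = 0" "e (Suc N) a = 0"
        by (simp_all add: e_def P_def gegenbauer_diff_beyond)
      ultimately show ?thesis
        unfolding U_def U1_def U2_def by (simp add: algebra_simps)
    qed
    \<comment> \<open>At a = 0 the base \<open>\<sigma> a\<close> is 0, so only j = 0 and, after one
      differentiation, j = 1 survive.\<close>
    have split: "(\<Sum>j\<le>N. f j) = f 0 + f 1" if "\<And>j. 2 \<le> j \<Longrightarrow> f j = 0" for f :: "nat \<Rightarrow> real"
    proof -
      have "(\<Sum>j\<le>N. f j) = (\<Sum>j\<in>{0, 1}. f j)"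
        by (rule sum.mono_neutral_right) (use False that in auto)
      then show ?thesis by simp
    qed
    have "gegenbauer N k 1 \<noteq> 0"
      using pochhammer_pos[of "2 * k" N] \<open>0 < k\<close> by (simp add: gegenbauer_at_1)
    moreover have "(\<Sum>j\<le>N. T j 0) = P 0 (cos b)"
      by (subst split) (simp_all add: T_def \<sigma>_def y_def w_def)
    ultimately show "U 0 = 0"
      by (simp add: U_def Z_def C_def P_def gegenbauer_diff_0)
    \<comment> \<open>The two surviving terms are sin b * P 1 (cos b) and its negative, since
      \<open>product_weight k 1\<close> is 1/2, the mean of the symmetric Beta distribution.\<close>
    have "(\<Sum>j\<le>N. T1 j 0) = 0"
      by (subst split) (use \<open>0 < k\<close> in
        \<open>simp_all add: T1_def \<sigma>_def \<sigma>'_def y_def y'_def w_def product_weight_def power_0_left\<close>)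
    then show "U1 0 = 0"
      by (simp add: U1_def Z1_def)
    show "0 < \<mu>"
      using False \<open>0 < k\<close> by (simp add: \<mu>_def)
  qed (use assms in auto)
  then show ?thesis
    by (simp add: U_def T_def Z_def C_def w_def P_def \<sigma>_def y_def gegenbauer_diff_0 mult.commute
        mult.left_commute)
qed (simp add: gegenbauer_diff_0)

text \<open>Both sides are invariant under (a, b) -> (pi - a, pi - b), where the parity sign occurs
  squared, under (a, b) -> (-a, -b), and under a -> a + 2 pi. Together these move every a into the
  first quadrant, with b arbitrary.\<close>

lemma gegenbauer_product:
  assumes "0 < k"
  shows "gegenbauer N k (cos a) * gegenbauer N k (cos b) / gegenbauer N k 1 =
    (\<Sum>j\<le>N. product_weight k j * (- 2 * sin a * sin b) ^ j * gegenbauer_diff N k j (cos (a - b)))"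
    (is "?L a b = ?R a b")
proof -
  have half: "?L a b = ?R a b" if "0 \<le> a" "a \<le> pi" for a b
  proof (cases "a \<le> pi / 2")
    case False
    have "?L (pi - a) (pi - b) = ?R (pi - a) (pi - b)"
      by (rule gegenbauer_product_quadrant) (use assms that False in auto)
    moreover have "?L (pi - a) (pi - b) = ?L a b"
      by (simp add: gegenbauer_minus flip: power_mult_distrib)
    moreover have "cos (b - a) = cos (a - b)"
      by (metis cos_minus minus_diff_eq)
    ultimately show ?thesis
      by simp
  qed (use gegenbauer_product_quadrant assms that in auto)
  define a' where "a' = Arg (cis a)"
  have a': "cos a' = cos a" "sin a' = sin a"
    using cis_Arg[OF cis_neq_zero, of a] by (simp_all add: a'_def sgn_eq complex_eq_iff)
  have a'_le: "- pi < a'" "a' \<le> pi"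
    using Arg_bounded[of "cis a"] by (simp_all add: a'_def)
  have "?L a' b = ?R a' b"
  proof (cases "0 \<le> a'")
    case False
    have "?L (- a') (- b) = ?R (- a') (- b)"
      by (rule half) (use False a'_le in auto)
    moreover have "cos (b - a') = cos (a' - b)"
      by (metis cos_minus minus_diff_eq)
    ultimately show ?thesis
      by simp
  qed (use half a'_le in auto)
  then show ?thesis
    by (simp add: a' cos_diff)
qed

section \<open>Graded families and generating functions\<close>

text \<open>An N-th finite difference annihilates polynomials of degree below N. Pascal's rule turns
  the sum for \<open>Suc N\<close> into minus the sum for \<open>N\<close> of first differences, and
  these are again Pochhammer polynomials, of degree p - 1.\<close>

lemma sum_alternating_binomial_pochhammer_eq_0:
  fixes x :: real
  assumes "p < N"
  shows "(\<Sum>m\<le>N. (-1) ^ m * real (N choose m) * pochhammer (x + real m) p) = 0"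
  using assms
proof (induction N arbitrary: x p)
  case (Suc N)
  define f where "f m = pochhammer (x + real m) p" for m
  have diff: "f (Suc m) - f m = real p * pochhammer (x + 1 + real m) (p - 1)" for m
  proof (cases p)
    case (Suc q)
    have "pochhammer (x + real m + 1) (Suc q) = pochhammer (x + real m + 1) q * (x + real m + 1 + real q)"
      by (simp add: pochhammer_Suc)
    moreover have "pochhammer (x + real m) (Suc q) = (x + real m) * pochhammer (x + real m + 1) q"
      by (rule pochhammer_rec)
    ultimately show ?thesis
      using Suc by (simp add: f_def algebra_simps)
  qed (simp add: f_def)
  have "(\<Sum>m\<le>Suc N. (-1) ^ m * real (Suc N choose m) * f m) =
      f 0 + (\<Sum>m\<le>N. (-1) ^ Suc m * real (N choose Suc m) * f (Suc m))
      + (\<Sum>m\<le>N. (-1) ^ Suc m * real (N choose m) * f (Suc m))"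
    by (subst sum.atMost_Suc_shift) (simp add: algebra_simps sum.distrib sum_subtractf sum_negf)
  also have "f 0 + (\<Sum>m\<le>N. (-1) ^ Suc m * real (N choose Suc m) * f (Suc m)) =
      (\<Sum>m\<le>Suc N. (-1) ^ m * real (N choose m) * f m)"
    by (subst sum.atMost_Suc_shift) simp
  also have "\<dots> = (\<Sum>m\<le>N. (-1) ^ m * real (N choose m) * f m)"
    by simp
  also have "\<dots> + (\<Sum>m\<le>N. (-1) ^ Suc m * real (N choose m) * f (Suc m)) =
      - (\<Sum>m\<le>N. (-1) ^ m * real (N choose m) * (f (Suc m) - f m))"
    by (simp add: algebra_simps sum.distrib sum_subtractf sum_negf)
  also have "\<dots> = - real p * (\<Sum>m\<le>N. (-1) ^ m * real (N choose m) * pochhammer (x + 1 + real m) (p - 1))"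
    unfolding diff sum_distrib_left sum_negf[symmetric]
    by (intro sum.cong refl) (simp only: ac_simps minus_mult_left)
  also have "\<dots> = 0"
  proof (cases "p = 0")
    case False
    then have "(\<Sum>m\<le>N. (-1) ^ m * real (N choose m) * pochhammer (x + 1 + real m) (p - 1)) = 0"
      by (intro Suc.IH) (use Suc.prems in auto)
    then show ?thesis
      by simp
  qed simp
  finally show ?case
    by (simp add: f_def)
qed simp

text \<open>Once the lower coefficients are known to vanish, dividing by w^N and letting w decrease
  to 0 isolates \<open>c N\<close>. Positive w are enough, and only for them are the transforms
  computed.\<close>

lemma powser_coeff_eq_0:
  fixes c :: "nat \<Rightarrow> real"
  assumes "0 < \<epsilon>" and sums0: "\<And>w. 0 < w \<Longrightarrow> w < \<epsilon> \<Longrightarrow> (\<lambda>N. c N * w ^ N) sums 0"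
  shows "c N = 0"
proof (induction N rule: less_induct)
  case (less N)
  define d where "d i = c (i + N)" for i
  have d: "(\<lambda>i. d i * w ^ i) sums 0" if "0 < w" "w < \<epsilon>" for w
  proof -
    have "(\<lambda>i. c (i + N) * w ^ (i + N)) sums (0 - (\<Sum>i<N. c i * w ^ i))"
      using sums0[OF that] by (subst sums_iff_shift) simp
    also have "(\<Sum>i<N. c i * w ^ i) = 0"
      using less by simp
    finally have "(\<lambda>i. w ^ N * (d i * w ^ i)) sums (w ^ N * 0)"
      by (simp add: d_def power_add mult_ac)
    then show ?thesis
      by (subst (asm) sums_mult_iff) (use that in auto)
  qed
  have "((\<lambda>w. \<Sum>i. d i * w ^ i) \<longlongrightarrow> d 0) (at 0)"
  proof (rule powser_limit_0)
    fix x :: real assume x: "norm x < \<epsilon> / 2"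
    have "summable (\<lambda>i. d i * (\<epsilon> / 2) ^ i)"
      using d[of "\<epsilon> / 2"] \<open>0 < \<epsilon>\<close> by (auto simp: sums_iff)
    then have "summable (\<lambda>i. d i * x ^ i)"
      by (rule powser_inside) (use x \<open>0 < \<epsilon>\<close> in auto)
    then show "(\<lambda>i. d i * x ^ i) sums (\<Sum>i. d i * x ^ i)"
      by (rule summable_sums)
  qed (use \<open>0 < \<epsilon>\<close> in auto)
  then have "((\<lambda>w. \<Sum>i. d i * w ^ i) \<longlongrightarrow> d 0) (at_right 0)"
    by (rule filterlim_mono) (auto intro: at_le)
  moreover have "((\<lambda>w. \<Sum>i. d i * w ^ i) \<longlongrightarrow> 0) (at_right 0)"
  proof (rule tendsto_eventually)
    show "\<forall>\<^sub>F w in at_right 0. (\<Sum>i. d i * w ^ i) = 0"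
      using eventually_at_right_less[of 0] eventually_at_right_real[OF \<open>0 < \<epsilon>\<close>]
      by eventually_elim (use d in \<open>auto simp: sums_iff\<close>)
  qed
  ultimately have "d 0 = 0"
    using tendsto_unique trivial_limit_at_right_real by blast
  then show ?case
    by (simp add: d_def)
qed

text \<open>Absolute summability at the single radius \<epsilon> permits regrouping by degree for
  all weights of order \<epsilon>^N: both the powers w^N of the transform and the decaying weights
  of the original series.\<close>

lemma has_sum_graded:
  fixes s :: "'i \<Rightarrow> real" and d :: "'i \<Rightarrow> nat" and wt :: "nat \<Rightarrow> real"
  assumes "0 < \<epsilon>" and sm: "(\<lambda>i. \<bar>s i\<bar> * \<epsilon> ^ d i) summable_on I"
    and bound: "\<And>N. \<bar>wt N\<bar> \<le> K * \<epsilon> ^ N"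
  shows "(\<lambda>i. s i * wt (d i)) summable_on I"
    and "(\<lambda>N. infsum s {i \<in> I. d i = N} * wt N) sums (\<Sum>\<^sub>\<infinity>i\<in>I. s i * wt (d i))"
proof -
  have "(\<lambda>i. K * (\<bar>s i\<bar> * \<epsilon> ^ d i)) summable_on I"
    by (intro summable_on_cmult_right sm)
  then have "(\<lambda>i. norm (s i * wt (d i))) summable_on I"
  proof (rule Infinite_Sum.abs_summable_on_comparison_test')
    fix i
    have "\<bar>s i\<bar> * \<bar>wt (d i)\<bar> \<le> \<bar>s i\<bar> * (K * \<epsilon> ^ d i)"
      by (intro mult_left_mono bound) simp
    then show "norm (s i * wt (d i)) \<le> K * (\<bar>s i\<bar> * \<epsilon> ^ d i)"
      by (simp add: abs_mult mult_ac)
  qed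
  then show S: "(\<lambda>i. s i * wt (d i)) summable_on I"
    by (rule abs_summable_summable)
  define B where "B N = {i \<in> I. d i = N}" for N
  have fibre: "(s has_sum infsum s (B N)) (B N)" for N
  proof -
    have "(\<lambda>i. \<bar>s i\<bar> * \<epsilon> ^ d i) summable_on B N"
      by (rule summable_on_subset[OF sm]) (auto simp: B_def)
    then have "(\<lambda>i. \<bar>s i\<bar> * \<epsilon> ^ N) summable_on B N"
      by (rule summable_on_cong[THEN iffD1, rotated]) (auto simp: B_def)
    then have "(\<lambda>i. norm (s i)) summable_on B N"
      using summable_on_cmult_left'[of "\<epsilon> ^ N" "\<lambda>i. \<bar>s i\<bar>" "B N"] \<open>0 < \<epsilon>\<close> by simp
    then show ?thesis
      by (rule has_sum_infsum[OF abs_summable_summable])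
  qed
  have "bij_betw snd (Sigma UNIV B) I"
    by (rule bij_betwI[where g = "\<lambda>i. (d i, i)"]) (auto simp: B_def)
  from has_sum_reindex_bij_betw[OF this, of "\<lambda>i. s i * wt (d i)"] has_sum_infsum[OF S]
  have "((\<lambda>p. s (snd p) * wt (d (snd p))) has_sum (\<Sum>\<^sub>\<infinity>i\<in>I. s i * wt (d i))) (Sigma UNIV B)"
    by blast
  then have "((\<lambda>N. infsum s (B N) * wt N) has_sum (\<Sum>\<^sub>\<infinity>i\<in>I. s i * wt (d i))) UNIV"
  proof (rule has_sum_SigmaD)
    fix N :: nat
    have "((\<lambda>i. s i * wt N) has_sum infsum s (B N) * wt N) (B N)"
      by (intro has_sum_cmult_left fibre)
    then show "((\<lambda>i. s (snd (N, i)) * wt (d (snd (N, i)))) has_sum infsum s (B N) * wt N) (B N)"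
      by (subst has_sum_cong[of _ _ "\<lambda>i. s i * wt N"]) (auto simp: B_def)
  qed
  then show "(\<lambda>N. infsum s {i \<in> I. d i = N} * wt N) sums (\<Sum>\<^sub>\<infinity>i\<in>I. s i * wt (d i))"
    unfolding B_def by (rule has_sum_imp_sums)
qed

text \<open>Applied with the weights \<open>v ^ N / (\<gamma>)\<^sub>N\<close>, this is a formal inverse Laplace transform: it
  suffices to compare generating functions near the origin.\<close>

lemma graded_transfer:
  fixes s :: "'i \<Rightarrow> real" and t :: "'l \<Rightarrow> real" and d :: "'i \<Rightarrow> nat" and e :: "'l \<Rightarrow> nat"
  assumes "0 < \<epsilon>" and s: "(\<lambda>i. \<bar>s i\<bar> * \<epsilon> ^ d i) summable_on I"
    and t: "(\<lambda>i. \<bar>t i\<bar> * \<epsilon> ^ e i) summable_on L"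
    and eq: "\<And>w. 0 < w \<Longrightarrow> w < \<epsilon> \<Longrightarrow>
      (\<Sum>\<^sub>\<infinity>i\<in>I. s i * w ^ d i) = (\<Sum>\<^sub>\<infinity>i\<in>L. t i * w ^ e i)"
    and bound: "\<And>N. \<bar>wt N\<bar> \<le> K * \<epsilon> ^ N"
  shows "(\<Sum>\<^sub>\<infinity>i\<in>I. s i * wt (d i)) = (\<Sum>\<^sub>\<infinity>i\<in>L. t i * wt (e i))"
proof -
  define F where "F N = infsum s {i \<in> I. d i = N}" for N
  define G where "G N = infsum t {i \<in> L. e i = N}" for N
  have "F N - G N = 0" for N
  proof (rule powser_coeff_eq_0[OF \<open>0 < \<epsilon>\<close>])
    fix w :: real assume w: "0 < w" "w < \<epsilon>"
    have le: "\<bar>w ^ N\<bar> \<le> 1 * \<epsilon> ^ N" for N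
      using w by (simp add: power_mono)
    have "(\<lambda>N. F N * w ^ N - G N * w ^ N) sums
        ((\<Sum>\<^sub>\<infinity>i\<in>I. s i * w ^ d i) - (\<Sum>\<^sub>\<infinity>i\<in>L. t i * w ^ e i))"
      unfolding F_def G_def
      by (intro sums_diff has_sum_graded(2)[OF \<open>0 < \<epsilon>\<close> s le] has_sum_graded(2)[OF \<open>0 < \<epsilon>\<close> t le])
    then show "(\<lambda>N. (F N - G N) * w ^ N) sums 0"
      using eq[OF w] by (simp add: algebra_simps)
  qed
  then have "F = G"
    by auto
  then show ?thesis
    using has_sum_graded(2)[OF \<open>0 < \<epsilon>\<close> s bound] has_sum_graded(2)[OF \<open>0 < \<epsilon>\<close> t bound]
    by (simp add: F_def G_def fun_eq_iff sums_iff)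
qed

lemma summable_power_div_pochhammer:
  fixes x \<gamma> :: real
  assumes "0 < \<gamma>"
  shows "summable (\<lambda>N. x ^ N / pochhammer \<gamma> N)"
proof (rule summable_ratio_test[where c = "1/2" and N = "nat \<lceil>2 * \<bar>x\<bar>\<rceil>"])
  fix N assume "nat \<lceil>2 * \<bar>x\<bar>\<rceil> \<le> N"
  then have N: "2 * \<bar>x\<bar> \<le> real N"
    by linarith
  have pos: "0 < pochhammer \<gamma> N"
    using assms by (rule pochhammer_pos)
  have "norm (x ^ Suc N / pochhammer \<gamma> (Suc N)) = \<bar>x\<bar> / (\<gamma> + real N) * (\<bar>x\<bar> ^ N / pochhammer \<gamma> N)"
    using pos assms by (simp add: pochhammer_Suc abs_mult power_abs)
  also have "\<dots> \<le> 1/2 * (\<bar>x\<bar> ^ N / pochhammer \<gamma> N)"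
    using pos assms N by (intro mult_right_mono) (auto simp: field_simps)
  finally show "norm (x ^ Suc N / pochhammer \<gamma> (Suc N)) \<le> 1/2 * norm (x ^ N / pochhammer \<gamma> N)"
    using pos by (simp add: power_abs)
qed simp

text \<open>Pochhammer symbols outgrow every geometric sequence, so one fixed \<epsilon> serves
  every v. This is what removes any smallness condition on \<rho> * r.\<close>

lemma power_div_pochhammer_bounded:
  fixes v \<gamma> \<epsilon> :: real
  assumes "0 < \<gamma>" "0 < \<epsilon>"
  obtains K where "\<And>N. \<bar>v ^ N / pochhammer \<gamma> N\<bar> \<le> K * \<epsilon> ^ N"
proof -
  have "summable (\<lambda>N. (v / \<epsilon>) ^ N / pochhammer \<gamma> N)"
    by (rule summable_power_div_pochhammer[OF \<open>0 < \<gamma>\<close>])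
  then have "Bseq (\<lambda>N. (v / \<epsilon>) ^ N / pochhammer \<gamma> N)"
    by (intro convergent_imp_Bseq) (auto simp: convergent_def dest: summable_LIMSEQ_zero)
  then obtain K where K: "\<And>N. norm ((v / \<epsilon>) ^ N / pochhammer \<gamma> N) \<le> K"
    by (rule BseqE) blast
  have "\<bar>v ^ N / pochhammer \<gamma> N\<bar> \<le> K * \<epsilon> ^ N" for N
    using mult_right_mono[OF K[of N], of "\<epsilon> ^ N"] \<open>0 < \<epsilon>\<close>
    by (simp add: power_divide abs_mult)
  then show ?thesis
    by (rule that)
qed

section \<open>Binomial and Gegenbauer generating functions\<close>

lemma has_sum_pochhammer_powr:
  fixes \<beta> x :: real
  assumes "0 < \<beta>" "\<bar>x\<bar> < 1"
  shows "((\<lambda>l. pochhammer \<beta> l / fact l * x ^ l) has_sum (1 - x) powr (- \<beta>)) UNIV"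
proof -
  have "(\<lambda>l. pochhammer \<beta> l / fact l * z ^ l) sums (1 - z) powr (- \<beta>)" if "\<bar>z\<bar> < 1" for z
    using gen_binomial_real[of "- z" "- \<beta>"] that
    by (simp add: gbinomial_pochhammer power_mult_distrib[symmetric] mult_ac flip: power_minus)
  from this[of x] this[of "\<bar>x\<bar>"] assms show ?thesis
    by (intro norm_summable_imp_has_sum) (auto simp: sums_iff abs_mult power_abs pochhammer_nonneg)
qed

lemma gegenbauer_summable:
  assumes "0 < k" "\<bar>t\<bar> \<le> 1" "\<bar>q\<bar> < 1/3"
  shows "summable (\<lambda>l. \<bar>gegenbauer l k t * q ^ l\<bar>)"
    and "(\<Sum>\<^sub>\<infinity>l. \<bar>gegenbauer l k t * q ^ l\<bar>) \<le> (1 - 3 * \<bar>q\<bar>) powr (- 2 * k)"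
proof -
  have hs: "((\<lambda>l. pochhammer (2 * k) l / fact l * (3 * \<bar>q\<bar>) ^ l) has_sum (1 - 3 * \<bar>q\<bar>) powr (- 2 * k)) UNIV"
    using has_sum_pochhammer_powr[of "2 * k" "3 * \<bar>q\<bar>"] assms by simp
  have le: "\<bar>gegenbauer l k t * q ^ l\<bar> \<le> pochhammer (2 * k) l / fact l * (3 * \<bar>q\<bar>) ^ l" for l
    using mult_right_mono[OF abs_gegenbauer_le[OF assms(1,2), of l], of "\<bar>q\<bar> ^ l"]
    by (simp add: abs_mult power_abs power_mult_distrib mult_ac)
  have sm: "(\<lambda>l. \<bar>gegenbauer l k t * q ^ l\<bar>) summable_on UNIV"
    by (rule summable_on_comparison_test[OF has_sum_imp_summable[OF hs]]) (use le in auto)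
  then show "summable (\<lambda>l. \<bar>gegenbauer l k t * q ^ l\<bar>)"
    by (rule summable_on_imp_summable)
  show "(\<Sum>\<^sub>\<infinity>l. \<bar>gegenbauer l k t * q ^ l\<bar>) \<le> (1 - 3 * \<bar>q\<bar>) powr (- 2 * k)"
    using infsumI[OF hs] infsum_mono[OF sm has_sum_imp_summable[OF hs] le] by simp
qed

text \<open>Read as an identity of formal series, the three-term recurrence is W F' = 2 k (t - q) F
  with W = 1 - 2 q t + q^2. Hence F * W powr k has derivative 0.\<close>

lemma gegenbauer_generating_function:
  assumes "0 < k" "\<bar>t\<bar> \<le> 1" "\<bar>q\<bar> < 1/3"
  shows "((\<lambda>l. gegenbauer l k t * q ^ l) has_sum (1 - 2 * q * t + q\<^sup>2) powr (- k)) UNIV"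
proof -
  define F where "F = Abs_fps (\<lambda>l. gegenbauer l k t)"
  have "ereal (1/3) \<le> conv_radius (\<lambda>l. gegenbauer l k t)"
  proof (rule conv_radius_geI_ex')
    fix r :: real assume "0 < r" "ereal r < ereal (1/3)"
    then show "summable (\<lambda>l. gegenbauer l k t * of_real r ^ l)"
      using gegenbauer_summable(1)[OF assms(1,2), of r] by (auto intro: summable_rabs_cancel)
  qed
  then have radius: "ereal (1/3) \<le> fps_conv_radius F"
    by (simp add: F_def fps_conv_radius_def)
  have fps_ode: "fps_of_poly [:1, - 2 * t, 1:] * fps_deriv F = fps_of_poly [:2 * k * t, - 2 * k:] * F"
  proof (rule fps_ext)
    fix n
    consider "n = 0" | "n = 1" | m where "n = Suc (Suc m)"
      by (metis One_nat_def not0_implies_Suc)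
    then show "fps_nth (fps_of_poly [:1, - 2 * t, 1:] * fps_deriv F) n =
        fps_nth (fps_of_poly [:2 * k * t, - 2 * k:] * F) n"
    proof cases
      case (3 m)
      have "(real m + 3) * gegenbauer (Suc (Suc (Suc m))) k t =
          2 * (real m + 2 + k) * t * gegenbauer (Suc (Suc m)) k t - (real m + 1 + 2 * k) * gegenbauer (Suc m) k t"
        by (simp add: add_ac)
      then show ?thesis
        by (simp add: 3 F_def fps_of_poly_pCons algebra_simps del: gegenbauer.simps)
    qed (simp_all add: F_def fps_of_poly_pCons algebra_simps add_divide_distrib diff_divide_distrib)
  qed
  define W where "W q = 1 - 2 * q * t + q\<^sup>2" for q
  have W_pos: "0 < W q" if "\<bar>q\<bar> < 1/3" for q
  proof -
    have "\<bar>q * t\<bar> \<le> \<bar>q\<bar> * 1"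
      unfolding abs_mult using assms by (intro mult_left_mono) auto
    then have "q * t < 1/3"
      using that by linarith
    then show ?thesis
      unfolding W_def using zero_le_power2[of q] by linarith
  qed
  have in_radius: "ereal (norm q) < fps_conv_radius F" if "\<bar>q\<bar> < 1/3" for q :: real
    using that radius by (metis ereal_less_eq(3) less_ereal.simps(1) order_less_le_trans real_norm_def)
  have in_radius': "ereal (norm q) < fps_conv_radius (fps_deriv F)" if "\<bar>q\<bar> < 1/3" for q :: real
    using in_radius[OF that] fps_conv_radius_deriv[of F] by (rule order_less_le_trans)
  have ode: "W q * eval_fps (fps_deriv F) q = 2 * k * (t - q) * eval_fps F q" if "\<bar>q\<bar> < 1/3" for q
  proof -
    have "eval_fps (fps_of_poly [:1, - 2 * t, 1:] * fps_deriv F) q = eval_fps (fps_of_poly [:2 * k * t, - 2 * k:] * F) q"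
      by (simp only: fps_ode)
    then show ?thesis
      using in_radius[OF that] in_radius'[OF that]
      by (simp add: eval_fps_mult W_def algebra_simps power2_eq_square)
  qed
  define h where "h q = eval_fps F q * W q powr k" for q
  have "\<exists>c. \<forall>q\<in>{-1/3<..<1/3}. h q = c"
  proof (rule has_field_derivative_zero_constant)
    fix q :: real assume "q \<in> {-1/3<..<1/3}"
    then have q: "\<bar>q\<bar> < 1/3"
      by auto
    have "(h has_real_derivative eval_fps (fps_deriv F) q * W q powr k
        + eval_fps F q * (k * W q powr (k - 1) * (2 * q - 2 * t))) (at q within {-1/3<..<1/3})"
      unfolding h_def W_def
      using in_radius[OF q] W_pos[OF q]
      by (auto intro!: derivative_eq_intros has_field_derivative_eval_fps simp: W_def)
    moreover have "W q powr k = W q * W q powr (k - 1)"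
      using W_pos[OF q] by (simp add: powr_mult_base)
    ultimately show "(h has_real_derivative 0) (at q within {-1/3<..<1/3})"
      using ode[OF q] by (elim DERIV_cong) algebra
  qed simp
  then obtain c where "\<forall>q\<in>{-1/3<..<1/3}. h q = c"
    by blast
  then have c: "h q = c" if "\<bar>q\<bar> < 1/3" for q
    by (rule bspec) (use that in \<open>unfold greaterThanLessThan_iff, linarith\<close>)
  have "c = h 0"
    by (simp add: c)
  also have "h 0 = 1"
    by (simp add: h_def W_def eval_fps_at_0 F_def)
  finally have "eval_fps F q * W q powr k = 1"
    using c[OF assms(3)] by (simp add: h_def)
  then have "eval_fps F q = W q powr (- k)"
    using W_pos[OF assms(3)] by (simp add: powr_minus field_simps)
  then have "(\<lambda>l. gegenbauer l k t * q ^ l) sums W q powr (- k)"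
    using sums_eval_fps[OF in_radius[OF assms(3)]] by (simp add: F_def)
  then show ?thesis
    using gegenbauer_summable(1)[OF assms] by (intro norm_summable_imp_has_sum) (auto simp: W_def)
qed

section \<open>The Poisson kernel\<close>

text \<open>The additional (k)_j is the Pochhammer factor of the j-th derivative of a Gegenbauer
  polynomial. In full this is (k)_j (k)_j / ((2k)_j j!), as in the theorem.\<close>

definition kernel_weight :: "real \<Rightarrow> nat \<Rightarrow> real" where
  "kernel_weight k j = pochhammer k j * product_weight k j"

definition gegenbauer_zonal :: "nat \<Rightarrow> real \<Rightarrow> real \<Rightarrow> real \<Rightarrow> real" where
  "gegenbauer_zonal j k a b = gegenbauer j k (cos a) * gegenbauer j k (cos b) / gegenbauer j k 1"

lemma kernel_weight_nonneg: "0 < k \<Longrightarrow> 0 \<le> kernel_weight k j"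
  by (simp add: kernel_weight_def product_weight_def pochhammer_nonneg)

lemma kernel_weight_le:
  assumes "0 < k"
  shows "kernel_weight k j \<le> pochhammer k j / fact j"
proof -
  have "pochhammer k j \<le> pochhammer (2 * k) j"
    unfolding pochhammer_prod by (rule prod_mono) (use assms in auto)
  moreover have "0 < pochhammer (2 * k) j"
    using assms by (intro pochhammer_pos) simp
  ultimately have "pochhammer k j / pochhammer (2 * k) j \<le> 1"
    by simp
  then have "pochhammer k j / fact j * (pochhammer k j / pochhammer (2 * k) j) \<le> pochhammer k j / fact j * 1"
    by (rule mult_left_mono) (use assms in \<open>simp add: pochhammer_nonneg\<close>)
  then show ?thesis
    by (simp add: kernel_weight_def product_weight_def mult_ac)
qed

lemma kernel_weight_summable:
  assumes "0 < k" "\<bar>x\<bar> < 1"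
  shows "(\<lambda>j. kernel_weight k j * \<bar>x\<bar> ^ j) summable_on UNIV"
proof (rule summable_on_comparison_test)
  show "(\<lambda>j. pochhammer k j / fact j * \<bar>x\<bar> ^ j) summable_on UNIV"
    using has_sum_imp_summable[OF has_sum_pochhammer_powr[of k "\<bar>x\<bar>"]] assms by simp
  show "kernel_weight k j * \<bar>x\<bar> ^ j \<le> pochhammer k j / fact j * \<bar>x\<bar> ^ j" for j
    by (intro mult_right_mono kernel_weight_le assms) simp
qed (use assms in \<open>simp add: kernel_weight_nonneg\<close>)

text \<open>Insert the product formula and write N = j + l. For fixed j the sum over l is the
  generating function of parameter k + j; for fixed N the sum over j is the zonal term.\<close>

lemma gegenbauer_poisson_kernel:
  fixes k q a b :: real
  assumes "0 < k" and q: "0 < q" "q \<le> 1/12"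
  shows "(\<lambda>N. gegenbauer_zonal N k a b * q ^ N) sums
    (\<Sum>\<^sub>\<infinity>j. kernel_weight k j * (- 4 * q * sin a * sin b) ^ j *
      (1 - 2 * q * cos (a - b) + q\<^sup>2) powr (- (k + real j)))"
proof -
  define y where "y = cos (a - b)"
  define W where "W = 1 - 2 * q * y + q\<^sup>2"
  define f where "f = (\<lambda>(j, l). kernel_weight k j * (- 4 * sin a * sin b) ^ j * gegenbauer l (k + real j) y)"
  define d where "d = (\<lambda>(j, l). j + l :: nat)"
  have y: "\<bar>y\<bar> \<le> 1"
    by (simp add: y_def)
  have inner_abs: "(\<Sum>\<^sub>\<infinity>l. \<bar>gegenbauer l (k + real j) y * q ^ l\<bar>) \<le> (1 - 3 * q) powr (- 2 * (k + real j))"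
    and inner_summable: "(\<lambda>l. \<bar>gegenbauer l (k + real j) y * q ^ l\<bar>) summable_on UNIV" for j
    using gegenbauer_summable[of "k + real j" y q] q y \<open>0 < k\<close>
    by (auto intro: summable_nonneg_imp_summable_on)
  \<comment> \<open>The ratio of the majorant in j: 4 q from the kernel, (1 - 3 q)^(-2) from raising
    the parameter in the inner bound by one. It is below 1 as long as q < 1/9.\<close>
  have sq: "4 * q / (1 - 3 * q)\<^sup>2 < 1"
  proof -
    have "(3/4)\<^sup>2 \<le> (1 - 3 * q)\<^sup>2"
      using q by (intro power_mono) auto
    then show ?thesis
      using q by (simp add: power2_eq_square divide_less_eq)
  qed
  have bound_summable: "(\<lambda>j. kernel_weight k j * (4 * q) ^ j * (1 - 3 * q) powr (- 2 * (k + real j))) summable_on UNIV"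
  proof -
    have "(\<lambda>j. (1 - 3 * q) powr (- 2 * k) * (kernel_weight k j * \<bar>4 * q / (1 - 3 * q)\<^sup>2\<bar> ^ j)) summable_on UNIV"
      using sq q by (intro summable_on_cmult_right kernel_weight_summable \<open>0 < k\<close>) simp
    moreover have "(1 - 3 * q) powr (- 2 * k) * (kernel_weight k j * \<bar>4 * q / (1 - 3 * q)\<^sup>2\<bar> ^ j) =
        kernel_weight k j * (4 * q) ^ j * (1 - 3 * q) powr (- 2 * (k + real j))" for j
    proof -
      have "(1 - 3 * q) powr (- 2 * (k + real j)) = (1 - 3 * q) powr (- 2 * k) * (1 - 3 * q) powr (- real (2 * j))"
        by (simp add: distrib_left flip: powr_add)
      also have "(1 - 3 * q) powr (- real (2 * j)) = 1 / ((1 - 3 * q)\<^sup>2) ^ j"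
        using q by (simp only: powr_minus powr_realpow power_mult inverse_eq_divide)
      finally show ?thesis
        using q by (simp add: power_divide)
    qed
    ultimately show ?thesis
      by (simp only:)
  qed
  have abs: "(\<lambda>p. \<bar>f p\<bar> * q ^ d p) summable_on UNIV"
  proof -
    have eq: "norm (f (j, l) * q ^ d (j, l)) =
        kernel_weight k j * (4 * q * \<bar>sin a * sin b\<bar>) ^ j * \<bar>gegenbauer l (k + real j) y * q ^ l\<bar>" for j l
      using kernel_weight_nonneg[OF \<open>0 < k\<close>, of j] q
      by (simp add: f_def d_def abs_mult power_add power_mult_distrib power_abs)
    have "(\<lambda>p. norm (f p * q ^ d p)) summable_on (UNIV \<times> UNIV)"
    proof (subst Infinite_Sum.abs_summable_on_Sigma_iff, intro conjI ballI)
      show "(\<lambda>l. norm (f (j, l) * q ^ d (j, l))) summable_on UNIV" for j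
        unfolding eq by (intro summable_on_cmult_right inner_summable)
      show "(\<lambda>j. norm (\<Sum>\<^sub>\<infinity>l. norm (f (j, l) * q ^ d (j, l)))) summable_on UNIV"
      proof (rule Infinite_Sum.abs_summable_on_comparison_test'[OF bound_summable])
        fix j
        have "norm (\<Sum>\<^sub>\<infinity>l. norm (f (j, l) * q ^ d (j, l))) =
            kernel_weight k j * (4 * q * \<bar>sin a * sin b\<bar>) ^ j * (\<Sum>\<^sub>\<infinity>l. \<bar>gegenbauer l (k + real j) y * q ^ l\<bar>)"
          unfolding eq infsum_cmult_right' using kernel_weight_nonneg[OF \<open>0 < k\<close>, of j] q
          by (simp add: abs_mult infsum_nonneg)
        also have "\<dots> \<le> kernel_weight k j * (4 * q) ^ j * (1 - 3 * q) powr (- 2 * (k + real j))"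
        proof (rule mult_mono[OF mult_left_mono inner_abs])
          have "\<bar>sin a\<bar> * \<bar>sin b\<bar> \<le> 1 * 1"
            by (intro mult_mono) auto
          then have "4 * q * \<bar>sin a * sin b\<bar> \<le> 4 * q * 1"
            using q by (intro mult_left_mono) (auto simp: abs_mult)
          then show "(4 * q * \<bar>sin a * sin b\<bar>) ^ j \<le> (4 * q) ^ j"
            using q by (intro power_mono) auto
        qed (use q \<open>0 < k\<close> in \<open>auto simp: kernel_weight_nonneg infsum_nonneg\<close>)
        finally show "norm (\<Sum>\<^sub>\<infinity>l. norm (f (j, l) * q ^ d (j, l)))
            \<le> kernel_weight k j * (4 * q) ^ j * (1 - 3 * q) powr (- 2 * (k + real j))" .
      qed
    qed
    then show ?thesis
      using q by (simp add: abs_mult)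
  qed
  have le: "\<bar>q ^ N\<bar> \<le> 1 * q ^ N" for N
    using q by simp
  note graded = has_sum_graded[OF q(1) abs le]
  have fibre: "infsum f {p \<in> UNIV. d p = N} = gegenbauer_zonal N k a b" for N
  proof -
    have "infsum f {p \<in> UNIV. d p = N} = (\<Sum>\<^sub>\<infinity>j\<in>{..N}. f (j, N - j))"
      by (rule infsum_reindex_bij_betw[symmetric], rule bij_betwI[where g = fst])
        (auto simp: d_def)
    also have "\<dots> = (\<Sum>j\<le>N. f (j, N - j))"
      by simp
    also have "\<dots> = gegenbauer_zonal N k a b"
      unfolding gegenbauer_zonal_def gegenbauer_product[OF \<open>0 < k\<close>]
    proof (rule sum.cong)
      fix j assume "j \<in> {..N}"
      then have "int N - int j = int (N - j)"
        by simp
      \<comment> \<open>The split-off \<open>2 ^ j\<close> is the one in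
        \<open>gegenbauer_diff\<close>.\<close>
      moreover have "(- 4 * sin a * sin b) ^ j = (- 2 * sin a * sin b) ^ j * 2 ^ j"
        by (simp add: mult.assoc flip: power_mult_distrib)
      ultimately show "f (j, N - j) =
          product_weight k j * (- 2 * sin a * sin b) ^ j * gegenbauer_diff N k j (cos (a - b))"
        by (simp only: f_def gegenbauer_diff_def kernel_weight_def y_def geg_of_nat case_prod_conv mult_ac)
    qed simp
    finally show ?thesis .
  qed
  have "(\<Sum>\<^sub>\<infinity>p. f p * q ^ d p) = (\<Sum>\<^sub>\<infinity>j. \<Sum>\<^sub>\<infinity>l. f (j, l) * q ^ d (j, l))"
    using graded(1) infsum_Sigma'_banach[of "\<lambda>j l. f (j, l) * q ^ d (j, l)" UNIV "\<lambda>_. UNIV"]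
    by (simp add: case_prod_unfold)
  also have "\<dots> = (\<Sum>\<^sub>\<infinity>j. kernel_weight k j * (- 4 * q * sin a * sin b) ^ j * W powr (- (k + real j)))"
  proof (rule infsum_cong)
    fix j
    have "(\<Sum>\<^sub>\<infinity>l. gegenbauer l (k + real j) y * q ^ l) = W powr (- (k + real j))"
      unfolding W_def
      by (intro infsumI gegenbauer_generating_function) (use q \<open>0 < k\<close> y in auto)
    moreover have "(- 4 * q * sin a * sin b) ^ j = (- 4 * sin a * sin b) ^ j * q ^ j"
      by (simp add: mult_ac flip: power_mult_distrib)
    then have "f (j, l) * q ^ d (j, l) = kernel_weight k j * (- 4 * q * sin a * sin b) ^ j *
        (gegenbauer l (k + real j) y * q ^ l)" for l
      by (simp only: f_def d_def case_prod_conv power_add mult_ac)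
    ultimately show "(\<Sum>\<^sub>\<infinity>l. f (j, l) * q ^ d (j, l)) =
        kernel_weight k j * (- 4 * q * sin a * sin b) ^ j * W powr (- (k + real j))"
      by (simp add: infsum_cmult_right')
  qed
  finally show ?thesis
    using graded(2) unfolding fibre by (simp add: W_def y_def)
qed

section \<open>The Catalan substitution\<close>

text \<open>Equal to \<nu> / (\<nu> + 2 m) times the binomial coefficient of \<nu> + 2 m over m, the
  coefficient of z^m in B^\<nu> for the Catalan series B = 1 + z B^2. At z = t / (1 + t)^2 this
  series has the value 1 + t.\<close>

definition catalan_coeff :: "real \<Rightarrow> nat \<Rightarrow> real" where
  "catalan_coeff \<nu> m = pochhammer \<nu> (2 * m) / (fact m * pochhammer (\<nu> + 1) m)"

lemma catalan_coeff_nonneg: "0 < \<nu> \<Longrightarrow> 0 \<le> catalan_coeff \<nu> m"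
  by (simp add: catalan_coeff_def pochhammer_nonneg)

lemma catalan_coeff_summable:
  assumes "0 < \<nu>" "0 \<le> x" "x < 1/9"
  shows "(\<lambda>m. catalan_coeff \<nu> m * x ^ m) summable_on UNIV"
proof (rule summable_nonneg_imp_summable_on)
  show "summable (\<lambda>m. catalan_coeff \<nu> m * x ^ m)"
  proof (rule summable_ratio_test[where c = "9 * x" and N = "nat \<lceil>\<nu>\<rceil>"])
    fix m assume "nat \<lceil>\<nu>\<rceil> \<le> m"
    then have m: "\<nu> \<le> real m"
      by linarith
    have "pochhammer \<nu> (2 * Suc m) = pochhammer \<nu> (2 * m) * ((\<nu> + 2 * real m) * (\<nu> + 2 * real m + 1))"
      by (simp add: pochhammer_Suc mult_ac add_ac)
    \<comment> \<open>The ratios of the coefficients tend to 4; comparing factor by factor, with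
      constant 3 each, gives 9, which is enough here.\<close>
    moreover have "(\<nu> + 2 * real m) * (\<nu> + 2 * real m + 1) \<le> (3 * (real m + 1)) * (3 * (\<nu> + 1 + real m))"
      using m \<open>0 < \<nu>\<close> by (intro mult_mono) auto
    ultimately have "pochhammer \<nu> (2 * Suc m) \<le> pochhammer \<nu> (2 * m) * ((3 * (real m + 1)) * (3 * (\<nu> + 1 + real m)))"
      using \<open>0 < \<nu>\<close> by (simp only:) (intro mult_left_mono pochhammer_nonneg)
    then have "catalan_coeff \<nu> (Suc m) \<le> pochhammer \<nu> (2 * m) * ((3 * (real m + 1)) * (3 * (\<nu> + 1 + real m)))
        / (fact (Suc m) * pochhammer (\<nu> + 1) (Suc m))"
      unfolding catalan_coeff_def using \<open>0 < \<nu>\<close>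
      by (intro divide_right_mono mult_nonneg_nonneg pochhammer_nonneg) auto
    also have "\<dots> = 9 * catalan_coeff \<nu> m"
      using \<open>0 < \<nu>\<close> by (simp add: catalan_coeff_def pochhammer_Suc divide_simps)
        (simp add: algebra_simps)
    finally have "catalan_coeff \<nu> (Suc m) \<le> 9 * catalan_coeff \<nu> m" .
    then have "catalan_coeff \<nu> (Suc m) * (x * x ^ m) \<le> 9 * catalan_coeff \<nu> m * (x * x ^ m)"
      using \<open>0 \<le> x\<close> by (intro mult_right_mono) auto
    then show "norm (catalan_coeff \<nu> (Suc m) * x ^ Suc m) \<le> 9 * x * norm (catalan_coeff \<nu> m * x ^ m)"
      using \<open>0 < \<nu>\<close> \<open>0 \<le> x\<close> by (simp add: catalan_coeff_nonneg mult_ac)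
  qed (use assms in auto)
qed (use assms in \<open>simp add: catalan_coeff_nonneg\<close>)

text \<open>After multiplication by \<open>(1 + t) powr -\<nu>\<close> and expansion in powers of \<open>t\<close>, the coefficient of
  \<open>t ^ N\<close> is the \<open>N\<close>-th difference of a polynomial of degree \<open>N - 1\<close>.\<close>

lemma catalan_has_sum:
  assumes "0 < \<nu>" and t: "0 < t" "t \<le> 1/16"
  shows "((\<lambda>m. catalan_coeff \<nu> m * (t / (1 + t)\<^sup>2) ^ m) has_sum (1 + t) powr \<nu>) UNIV"
proof -
  \<comment> \<open>Coefficients of the expansion of t^m (1 + t)^(-\<nu> - 2 m) in powers of t,
    weighted by \<open>catalan_coeff\<close>. Everything except the constant term has to
    cancel.\<close>
  define f where "f = (\<lambda>(m, l). catalan_coeff \<nu> m * (pochhammer (\<nu> + 2 * real m) l / fact l * (-1) ^ l))"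
  define d where "d = (\<lambda>(m, l). m + l :: nat)"
  have inner: "((\<lambda>l. pochhammer (\<nu> + 2 * real m) l / fact l * x ^ l) has_sum (1 - x) powr (- (\<nu> + 2 * real m))) UNIV"
    if "\<bar>x\<bar> < 1" for x m
    using has_sum_pochhammer_powr[of "\<nu> + 2 * real m" x] \<open>0 < \<nu>\<close> that by simp
  have outer: "t ^ m * z powr (- (\<nu> + 2 * real m)) = z powr (- \<nu>) * (t / z\<^sup>2) ^ m" if "0 < z" for z m
  proof -
    have "z powr (- (\<nu> + 2 * real m)) = z powr (- \<nu>) * z powr (- real (2 * m))"
      by (simp flip: powr_add)
    also have "z powr (- real (2 * m)) = 1 / (z\<^sup>2) ^ m"
      using that by (simp only: powr_minus powr_realpow power_mult inverse_eq_divide)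
    finally show ?thesis
      by (simp add: power_divide)
  qed
  have abs: "(\<lambda>p. \<bar>f p\<bar> * t ^ d p) summable_on UNIV"
  proof -
    have eq: "norm (f (m, l) * t ^ d (m, l)) =
        catalan_coeff \<nu> m * t ^ m * (pochhammer (\<nu> + 2 * real m) l / fact l * t ^ l)" for m l
      using catalan_coeff_nonneg[OF \<open>0 < \<nu>\<close>, of m] t pochhammer_nonneg[of "\<nu> + 2 * real m" l] \<open>0 < \<nu>\<close>
      by (simp add: f_def d_def abs_mult power_add)
    have "\<bar>t\<bar> < 1"
      using t by simp
    note inner_t = inner[OF this]
    have "(\<lambda>p. norm (f p * t ^ d p)) summable_on (UNIV \<times> UNIV)"
    proof (subst Infinite_Sum.abs_summable_on_Sigma_iff, intro conjI ballI)
      show "(\<lambda>l. norm (f (m, l) * t ^ d (m, l))) summable_on UNIV" for m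
        unfolding eq by (intro summable_on_cmult_right has_sum_imp_summable[OF inner_t])
      \<comment> \<open>Absolute values turn 1 + t into 1 - t; t <= 1/16 gives t / (1 - t)^2 <=
        16/225 < 1/9, as \<open>catalan_coeff_summable\<close> demands.\<close>
      have "(15/16)\<^sup>2 \<le> (1 - t)\<^sup>2"
        using t by (intro power_mono) auto
      then have "t / (1 - t)\<^sup>2 < 1/9"
        using t by (simp add: power2_eq_square divide_less_eq)
      then have "(\<lambda>m. (1 - t) powr (- \<nu>) * (catalan_coeff \<nu> m * (t / (1 - t)\<^sup>2) ^ m)) summable_on UNIV"
        using t \<open>0 < \<nu>\<close> by (intro summable_on_cmult_right catalan_coeff_summable) auto
      moreover have "(1 - t) powr (- \<nu>) * (catalan_coeff \<nu> m * (t / (1 - t)\<^sup>2) ^ m) =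
          norm (\<Sum>\<^sub>\<infinity>l. norm (f (m, l) * t ^ d (m, l)))" for m
      proof -
        have "(\<Sum>\<^sub>\<infinity>l. norm (f (m, l) * t ^ d (m, l))) =
            catalan_coeff \<nu> m * (t ^ m * (1 - t) powr (- (\<nu> + 2 * real m)))"
          unfolding eq infsum_cmult_right' infsumI[OF inner_t] by simp
        also have "\<dots> = catalan_coeff \<nu> m * ((1 - t) powr (- \<nu>) * (t / (1 - t)\<^sup>2) ^ m)"
          using t by (subst outer) auto
        finally show ?thesis
          using catalan_coeff_nonneg[OF \<open>0 < \<nu>\<close>, of m] t by (simp add: abs_mult)
      qed
      ultimately show "(\<lambda>m. norm (\<Sum>\<^sub>\<infinity>l. norm (f (m, l) * t ^ d (m, l)))) summable_on UNIV"
        by (simp only:)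
    qed
    then show ?thesis
      using t by (simp add: abs_mult)
  qed
  have le: "\<bar>t ^ N\<bar> \<le> 1 * t ^ N" for N
    using t by simp
  note graded = has_sum_graded[OF t(1) abs le]
  have fibre: "infsum f {p \<in> UNIV. d p = N} = (if N = 0 then 1 else 0)" for N
  proof -
    have "infsum f {p \<in> UNIV. d p = N} = (\<Sum>\<^sub>\<infinity>m\<in>{..N}. f (m, N - m))"
      by (rule infsum_reindex_bij_betw[symmetric], rule bij_betwI[where g = fst])
        (auto simp: d_def)
    also have "\<dots> = (\<Sum>m\<le>N. f (m, N - m))"
      by simp
    also have "\<dots> = (if N = 0 then 1 else 0)"
    proof (cases N)
      case (Suc M)
      have "f (m, N - m) = \<nu> * (-1) ^ N / fact N *
          ((-1) ^ m * real (N choose m) * pochhammer (\<nu> + 1 + real m) M)" if "m \<le> N" for m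
      proof -
        have "pochhammer \<nu> (2 * m) * pochhammer (\<nu> + 2 * real m) (N - m) = pochhammer \<nu> (m + N)"
          using pochhammer_product[of "2 * m" "m + N" \<nu>] that by simp
        also have "\<dots> = \<nu> * pochhammer (\<nu> + 1) (m + M)"
          by (simp add: Suc pochhammer_rec)
        also have "pochhammer (\<nu> + 1) (m + M) = pochhammer (\<nu> + 1) m * pochhammer (\<nu> + 1 + real m) M"
          by (rule pochhammer_product') 
        finally have P: "pochhammer \<nu> (2 * m) * pochhammer (\<nu> + 2 * real m) (N - m) =
            \<nu> * (pochhammer (\<nu> + 1) m * pochhammer (\<nu> + 1 + real m) M)" .
        have "0 < pochhammer (\<nu> + 1) m"
          using \<open>0 < \<nu>\<close> by (intro pochhammer_pos) simp
        moreover have "(-1 :: real) ^ (N - m) = (-1) ^ N * (-1) ^ m"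
          using that by (auto simp: minus_one_power_iff)
        ultimately show ?thesis
          using P binomial_fact[OF that, where 'a = real]
          by (simp add: f_def catalan_coeff_def field_simps)
      qed
      then have "(\<Sum>m\<le>N. f (m, N - m)) = \<nu> * (-1) ^ N / fact N *
          (\<Sum>m\<le>N. (-1) ^ m * real (N choose m) * pochhammer (\<nu> + 1 + real m) M)"
        by (simp add: sum_distrib_left)
      then show ?thesis
        by (subst (asm) sum_alternating_binomial_pochhammer_eq_0) (use Suc in auto)
    qed (simp add: f_def catalan_coeff_def)
    finally show ?thesis .
  qed
  have hs: "((\<lambda>p. f p * t ^ d p) has_sum 1) (UNIV \<times> UNIV)"
  proof -
    have "(\<lambda>N. (if N = 0 then 1 else 0) * t ^ N) sums (1 * t ^ 0)"
      using sums_finite[of "{0}" "\<lambda>N. (if N = 0 then 1 else 0) * t ^ N"] by simp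
    with graded(2) have "(\<Sum>\<^sub>\<infinity>p. f p * t ^ d p) = 1"
      unfolding fibre using sums_unique2 by fastforce
    then show ?thesis
      using has_sum_infsum[OF graded(1)] by simp
  qed
  have "((\<lambda>m. (1 + t) powr (- \<nu>) * (catalan_coeff \<nu> m * (t / (1 + t)\<^sup>2) ^ m)) has_sum 1) UNIV"
  proof (rule has_sum_SigmaD[OF hs])
    fix m
    have "((\<lambda>l. catalan_coeff \<nu> m * t ^ m * (pochhammer (\<nu> + 2 * real m) l / fact l * (- t) ^ l)) has_sum
        catalan_coeff \<nu> m * t ^ m * (1 - (- t)) powr (- (\<nu> + 2 * real m))) UNIV"
      by (intro has_sum_cmult_right inner) (use t in auto)
    moreover have "catalan_coeff \<nu> m * t ^ m * (1 - (- t)) powr (- (\<nu> + 2 * real m)) =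
        (1 + t) powr (- \<nu>) * (catalan_coeff \<nu> m * (t / (1 + t)\<^sup>2) ^ m)"
      using outer[of "1 + t" m] t by (simp add: mult_ac)
    moreover have "catalan_coeff \<nu> m * t ^ m * (pochhammer (\<nu> + 2 * real m) l / fact l * (- t) ^ l) =
        f (m, l) * t ^ d (m, l)" for l
      by (simp add: f_def d_def power_add power_minus[of t])
    ultimately show "((\<lambda>l. f (m, l) * t ^ d (m, l)) has_sum
        (1 + t) powr (- \<nu>) * (catalan_coeff \<nu> m * (t / (1 + t)\<^sup>2) ^ m)) UNIV"
      by (simp only:)
  qed
  from has_sum_cmult_right[OF this, of "(1 + t) powr \<nu>"] show ?thesis
    using t by (simp add: powr_minus field_simps)
qed

section \<open>The product over n equally spaced angles\<close>

lemma prod_roots_unity_diff: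
  fixes x y :: complex
  assumes "0 < n"
  shows "(\<Prod>s<n. (x - cis (2 * pi * real s / real n) * y)) = x ^ n - y ^ n"
proof (cases "y = 0")
  case False
  define A where "A = {z :: complex. z ^ n = 1}"
  have A: "finite A" "card A = n"
    using assms by (simp_all add: A_def finite_roots_unity card_roots_unity_eq)
  define p where "p = (\<Prod>z\<in>A. [:- z, 1:])"
  define q where "q = monom 1 n - (1 :: complex poly)"
  have deg_p: "degree p = n"
    unfolding p_def by (subst degree_prod_eq_sum_degree) (use A in auto)
  have lead_p: "coeff p n = 1"
    using lead_coeff_prod[of "\<lambda>z. [:- z, 1:]" A] deg_p by (simp add: p_def)
  have "p = q"
  proof (rule poly_eqI_degree_lead_coeff[where n = n and A = A])
    show "degree q \<le> n"
      unfolding q_def by (rule degree_diff_le) (auto simp: degree_monom_le)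
    show "coeff p n = coeff q n"
      using lead_p assms by (simp add: q_def)
    show "poly p z = poly q z" if "z \<in> A" for z
      using that A by (auto simp: p_def q_def poly_prod poly_monom A_def)
  qed (use A deg_p in auto)
  then have "poly p (x / y) = (x / y) ^ n - 1"
    by (simp add: q_def poly_monom)
  moreover have "poly p (x / y) = (\<Prod>z\<in>A. (x / y - z))"
    by (simp add: p_def poly_prod)
  moreover have "(\<Prod>z\<in>A. (x / y - z)) = (\<Prod>s<n. (x / y - cis (2 * pi * real s / real n)))"
    unfolding A_def by (rule prod.reindex_bij_betw[symmetric], rule Complex.bij_betw_roots_unity) fact
  ultimately have "(\<Prod>s<n. y * (x / y - cis (2 * pi * real s / real n))) = y ^ n * ((x / y) ^ n - 1)"
    by (simp add: prod.distrib)
  then show ?thesis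
    using False by (simp add: algebra_simps power_divide)
qed (use assms in simp)

text \<open>Each factor is |1 - u e^(i x)|^2. Factoring over the roots of unity, the product of the
  1 - u e^(i x) is 1 - u^n e^(i n \<alpha>).\<close>

lemma prod_one_minus_two_cos:
  fixes u \<alpha> :: real
  assumes "0 < n"
  shows "(\<Prod>s=1..n. 1 - 2 * u * cos (\<alpha> + 2 * pi * real s / real n) + u\<^sup>2) =
    1 - 2 * u ^ n * cos (real n * \<alpha>) + (u ^ n)\<^sup>2"
proof -
  define g where "g s = 1 - 2 * u * cos (\<alpha> + 2 * pi * real s / real n) + u\<^sup>2" for s :: nat
  have factor: "of_real (1 - 2 * v * cos \<beta> + v\<^sup>2) = (1 - of_real v * cis \<beta>) * (1 - of_real v * cis (- \<beta>))" for v \<beta>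
    by (simp add: complex_eq_iff algebra_simps power2_eq_square)
      (metis mult.assoc sin_cos_squared_add3 mult.right_neutral distrib_left)
  have half: "(\<Prod>s<n. (1 - of_real u * cis (\<beta> + 2 * pi * real s / real n))) = 1 - of_real u ^ n * cis (real n * \<beta>)" for \<beta>
    using prod_roots_unity_diff[OF assms, of 1 "of_real u * cis \<beta>"]
    by (simp add: power_mult_distrib Complex.DeMoivre mult_ac flip: cis_mult)
  \<comment> \<open>The index ranges differ only in s = n against s = 0, which are one full turn
    apart.\<close>
  have "(\<Prod>s=1..n. g s) = (\<Prod>s<n. g s)"
  proof -
    have "g n = g 0"
      using assms by (simp add: g_def)
    moreover have "(\<Prod>s=1..n. g s) * g 0 = (\<Prod>s\<le>n. g s)"
      by (simp add: atMost_atLeast0 prod.atLeast_Suc_atMost mult.commute)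
    moreover have "(\<Prod>s\<le>n. g s) = (\<Prod>s<n. g s) * g n"
      by (simp flip: lessThan_Suc_atMost)
    moreover have "(\<Prod>s=1..n. g s) = (\<Prod>s=1..<n. g s) * g n" "(\<Prod>s<n. g s) = g 0 * (\<Prod>s=1..<n. g s)"
      using assms by (simp_all add: prod.last_plus prod.atLeast_Suc_lessThan lessThan_atLeast0 mult.commute)
    ultimately show ?thesis
      by simp
  qed
  moreover have "of_real (\<Prod>s<n. g s) = (\<Prod>s<n. (1 - of_real u * cis (\<alpha> + 2 * pi * real s / real n)))
      * cnj (\<Prod>s<n. (1 - of_real u * cis (\<alpha> + 2 * pi * real s / real n)))"
    unfolding g_def of_real_prod factor by (simp add: prod.distrib cis_cnj)
  then have "of_real (\<Prod>s<n. g s) = complex_of_real (1 - 2 * u ^ n * cos (real n * \<alpha>) + (u ^ n)\<^sup>2)"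
    unfolding half by (simp only: factor) (simp add: cis_cnj)
  then have "(\<Prod>s<n. g s) = 1 - 2 * u ^ n * cos (real n * \<alpha>) + (u ^ n)\<^sup>2"
    by (simp only: of_real_eq_iff)
  ultimately show ?thesis
    by (simp add: g_def)
qed

section \<open>Comparison of the Laplace transforms\<close>

lemma gegenbauer_zonal_bound:
  assumes "0 < k"
  shows "\<bar>gegenbauer_zonal j k a b\<bar> \<le> 9 ^ j * pochhammer (2 * k) j / fact j"
proof -
  define g where "g = gegenbauer j k 1"
  have g: "0 < g" "g = pochhammer (2 * k) j / fact j"
    using assms by (simp_all add: g_def gegenbauer_at_1 pochhammer_pos)
  have "\<bar>gegenbauer j k (cos x)\<bar> \<le> 3 ^ j * g" for x
    using abs_gegenbauer_le[OF assms, of "cos x" j] by (simp add: g)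
  then have "\<bar>gegenbauer j k (cos a)\<bar> * \<bar>gegenbauer j k (cos b)\<bar> \<le> (3 ^ j * g) * (3 ^ j * g)"
    by (intro mult_mono) (use g(1) in auto)
  then have "\<bar>gegenbauer j k (cos a)\<bar> * \<bar>gegenbauer j k (cos b)\<bar> / g \<le> (3 ^ j * g) * (3 ^ j * g) / g"
    by (rule divide_right_mono) (use g(1) in simp)
  also have "\<bar>gegenbauer j k (cos a)\<bar> * \<bar>gegenbauer j k (cos b)\<bar> / g = \<bar>gegenbauer_zonal j k a b\<bar>"
    using g(1) by (simp add: gegenbauer_zonal_def abs_mult flip: g_def)
  also have "(3 ^ j * g) * (3 ^ j * g) / g = (3 * 3) ^ j * g"
    unfolding power_mult_distrib using g(1) by simp
  finally show ?thesis
    by (simp add: g)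
qed

lemma gegenbauer_zonal_summable:
  assumes "0 < k" "0 \<le> q" "q \<le> 1/12"
  shows "(\<lambda>j. \<bar>gegenbauer_zonal j k a b\<bar> * q ^ j) summable_on UNIV"
proof (rule summable_on_comparison_test)
  show "(\<lambda>j. pochhammer (2 * k) j / fact j * (9 * q) ^ j) summable_on UNIV"
    using assms by (intro has_sum_imp_summable[OF has_sum_pochhammer_powr]) auto
  show "\<bar>gegenbauer_zonal j k a b\<bar> * q ^ j \<le> pochhammer (2 * k) j / fact j * (9 * q) ^ j" for j
    using mult_right_mono[OF gegenbauer_zonal_bound[OF \<open>0 < k\<close>, of j a b], of "q ^ j"] assms
    by (simp add: power_mult_distrib mult_ac)
qed (use assms in auto)

text \<open>The coefficients, graded by the power of \<open>v\<close>, of the formal Laplace transforms of the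
  Bessel series and of the Horn series: the factor \<open>1 / pochhammer (n * k) N\<close> of \<open>v ^ N\<close> is
  removed.\<close>

definition bessel_coeff :: "nat \<Rightarrow> real \<Rightarrow> real \<Rightarrow> real \<Rightarrow> nat \<times> nat \<Rightarrow> real" where
  "bessel_coeff n k a b = (\<lambda>(j, m). gegenbauer_zonal j k a b / 2 ^ (n * j + 2 * m) *
     catalan_coeff (real n * (k + real j)) m)"

definition bessel_degree :: "nat \<Rightarrow> nat \<times> nat \<Rightarrow> nat" where
  "bessel_degree n = (\<lambda>(j, m). n * j + 2 * m)"

definition horn_coeff :: "nat \<Rightarrow> real \<Rightarrow> real \<Rightarrow> (nat \<Rightarrow> real) \<Rightarrow> nat \<times> (nat \<Rightarrow> nat) \<Rightarrow> real" where
  "horn_coeff n k S b = (\<lambda>(j, J). kernel_weight k j * (- 4 * S / 2 ^ n) ^ j *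
     (\<Prod>i=1..n. pochhammer (k + real j) (J i) / fact (J i) * b i ^ J i))"

definition horn_degree :: "nat \<Rightarrow> nat \<times> (nat \<Rightarrow> nat) \<Rightarrow> nat" where
  "horn_degree n = (\<lambda>(j, J). n * j + (\<Sum>i=1..n. J i))"

lemma prod_pochhammer_has_sum:
  fixes z :: "nat \<Rightarrow> real" and \<beta> :: real
  assumes "0 < \<beta>" "\<And>i. i \<in> {1..n} \<Longrightarrow> \<bar>z i\<bar> < 1"
  shows "((\<lambda>J. \<Prod>i=1..n. pochhammer \<beta> (J i) / fact (J i) * z i ^ J i) has_sum
    (\<Prod>i=1..n. (1 - z i) powr (- \<beta>))) ({1..n} \<rightarrow>\<^sub>E UNIV)"
proof -
  have prod: "(\<Sum>\<^sub>\<infinity>J\<in>{1..n} \<rightarrow>\<^sub>E UNIV. \<Prod>i=1..n. pochhammer \<beta> (J i) / fact (J i) * y i ^ J i) =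
      (\<Prod>i=1..n. (1 - y i) powr (- \<beta>))" if y: "\<And>i. i \<in> {1..n} \<Longrightarrow> \<bar>y i\<bar> < 1" for y :: "nat \<Rightarrow> real"
  proof -
    have "(\<Sum>\<^sub>\<infinity>J\<in>{1..n} \<rightarrow>\<^sub>E UNIV. \<Prod>i=1..n. pochhammer \<beta> (J i) / fact (J i) * y i ^ J i) =
      (\<Prod>i=1..n. \<Sum>\<^sub>\<infinity>l. pochhammer \<beta> l / fact l * y i ^ l)"
    proof (rule infsum_prod_PiE_abs)
      fix i assume i: "i \<in> {1..n}"
      have "(\<lambda>l. pochhammer \<beta> l / fact l * \<bar>y i\<bar> ^ l) summable_on UNIV"
        using y[OF i] \<open>0 < \<beta>\<close> by (intro has_sum_imp_summable[OF has_sum_pochhammer_powr]) auto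
      then show "(\<lambda>l. norm (pochhammer \<beta> l / fact l * y i ^ l)) summable_on UNIV"
        using \<open>0 < \<beta>\<close> by (simp add: abs_mult power_abs pochhammer_nonneg)
    qed simp
    also have "\<dots> = (\<Prod>i=1..n. (1 - y i) powr (- \<beta>))"
      by (intro prod.cong refl infsumI has_sum_pochhammer_powr \<open>0 < \<beta>\<close> y)
    finally show ?thesis .
  qed
  have "(\<Prod>i=1..n. (1 - \<bar>z i\<bar>) powr (- \<beta>)) \<noteq> 0"
    using assms(2) by (auto simp: less_imp_neq)
  \<comment> \<open>A nonzero \<open>infsum\<close> cannot be the junk value of a non-summable family.\<close>
  then have "(\<lambda>J. \<Prod>i=1..n. pochhammer \<beta> (J i) / fact (J i) * \<bar>z i\<bar> ^ J i) summable_on ({1..n} \<rightarrow>\<^sub>E UNIV)"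
    using prod[of "\<lambda>i. \<bar>z i\<bar>"] assms(2) infsum_not_exists by fastforce
  then have "(\<lambda>J. norm (\<Prod>i=1..n. pochhammer \<beta> (J i) / fact (J i) * z i ^ J i)) summable_on ({1..n} \<rightarrow>\<^sub>E UNIV)"
    using \<open>0 < \<beta>\<close> by (simp add: abs_prod abs_mult power_abs pochhammer_nonneg)
  then show ?thesis
    using prod[OF assms(2)] has_sum_infsum[OF abs_summable_summable] by fastforce
qed

lemma horn_coeff_eq:
  fixes w :: real
  shows "horn_coeff n k S b (j, J) * w ^ horn_degree n (j, J) = kernel_weight k j * (- 4 * (w / 2) ^ n * S) ^ j *
    (\<Prod>i=1..n. pochhammer (k + real j) (J i) / fact (J i) * (w * b i) ^ J i)"
proof -
  have "(\<Prod>i=1..n. pochhammer (k + real j) (J i) / fact (J i) * (w * b i) ^ J i) =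
      (\<Prod>i=1..n. (pochhammer (k + real j) (J i) / fact (J i) * b i ^ J i) * w ^ J i)"
    by (simp add: power_mult_distrib mult_ac)
  also have "\<dots> = (\<Prod>i=1..n. pochhammer (k + real j) (J i) / fact (J i) * b i ^ J i) * w ^ (\<Sum>i=1..n. J i)"
    by (simp only: prod.distrib power_sum)
  finally have P: "(\<Prod>i=1..n. pochhammer (k + real j) (J i) / fact (J i) * (w * b i) ^ J i) = \<dots>" .
  have "(- 4 * (w / 2) ^ n * S) ^ j = (- 4 * S / 2 ^ n * w ^ n) ^ j"
    by (simp add: power_divide mult_ac)
  also have "\<dots> = (- 4 * S / 2 ^ n) ^ j * w ^ (n * j)"
    by (simp only: power_mult_distrib power_mult)
  finally show ?thesis
    unfolding P by (simp add: horn_coeff_def horn_degree_def power_add mult_ac)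
qed

lemma rational_parametrization:
  fixes w :: real
  assumes "0 < w" "w \<le> 1/12"
  obtains u where "0 < u" "u \<le> 1/12" "w / 2 = u / (1 + u\<^sup>2)"
proof
  \<comment> \<open>The witness is the smaller root (1 - r) / w of w u^2 - 2 u + w = 0, in the form
    w / (1 + r), from which u <= w is immediate.\<close>
  define r where "r = sqrt (1 - w\<^sup>2)"
  have "w\<^sup>2 \<le> 1"
    using assms by (intro power_le_one) auto
  then have r: "0 \<le> r" "r\<^sup>2 = 1 - w\<^sup>2"
    by (simp_all add: r_def)
  show "0 < w / (1 + r)"
    using assms r by simp
  have "w / (1 + r) \<le> w / 1"
    using assms r by (intro divide_left_mono) auto
  then show "w / (1 + r) \<le> 1/12"
    using assms by linarith
  have "(1 + r)\<^sup>2 + w\<^sup>2 = 2 * (1 + r)"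
    using r by (simp add: power2_eq_square algebra_simps)
  moreover have "1 + (w / (1 + r))\<^sup>2 = ((1 + r)\<^sup>2 + w\<^sup>2) / (1 + r)\<^sup>2"
    using r by (simp add: power_divide add_divide_distrib)
  moreover have "2 * (1 + r) / (1 + r)\<^sup>2 = 2 / (1 + r)"
    using r by (simp add: power2_eq_square divide_simps)
  ultimately have "1 + (w / (1 + r))\<^sup>2 = 2 / (1 + r)"
    by (simp only:)
  then show "w / 2 = w / (1 + r) / (1 + (w / (1 + r))\<^sup>2)"
    using r by simp
qed

context
  fixes n :: nat and k u w :: real
  assumes n: "0 < n" and k: "0 < k" and u: "0 < u" "u \<le> 1/12"
    and w: "0 < w" "w \<le> 1/12" and wu: "w / 2 = u / (1 + u\<^sup>2)"
begin

lemma small_power: "0 < u ^ n" "u ^ n \<le> 1/12"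
proof -
  have "u ^ n \<le> u ^ 1"
    using n u by (intro power_decreasing) auto
  then show "0 < u ^ n" "u ^ n \<le> 1/12"
    using u by auto
qed

text \<open>Each of the n j factors w / 2 absorbs one factor 1 + u^2 and leaves u. This splits off
  the prefactor common to both transforms and produces q = u^n.\<close>

lemma parametrized_power:
  "(w / 2) ^ (n * j) * (1 + u\<^sup>2) powr (real n * (k + real j)) = (1 + u\<^sup>2) powr (real n * k) * (u ^ n) ^ j"
proof -
  have pos: "0 < 1 + u\<^sup>2"
    by (simp add: add_pos_nonneg)
  have "(1 + u\<^sup>2) powr (real n * (k + real j)) = (1 + u\<^sup>2) powr (real n * k) * (1 + u\<^sup>2) ^ (n * j)"
    using pos by (simp add: distrib_left powr_add flip: powr_realpow)
  then show ?thesis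
    unfolding wu using pos by (simp add: power_divide power_mult)
qed

text \<open>For fixed j the sum over m is the Catalan expansion with exponent n (k + j) and t = u^2,
  because (w / 2)^2 = t / (1 + t)^2.\<close>

lemma bessel_coeff_has_sum:
  "(\<lambda>p. \<bar>bessel_coeff n k a b p\<bar> * w ^ bessel_degree n p) summable_on UNIV"
  "(\<Sum>\<^sub>\<infinity>p. bessel_coeff n k a b p * w ^ bessel_degree n p) =
    (1 + u\<^sup>2) powr (real n * k) * (\<Sum>\<^sub>\<infinity>j. gegenbauer_zonal j k a b * (u ^ n) ^ j)"
proof -
  define c where "c = bessel_coeff n k a b"
  define d where "d = bessel_degree n"
  define Z where "Z = (\<lambda>j. gegenbauer_zonal j k a b)"
  have w2: "(w / 2)\<^sup>2 = u\<^sup>2 / (1 + u\<^sup>2)\<^sup>2"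
    unfolding wu by (simp add: power_divide)
  have eq: "c (j, m) * w ^ d (j, m) = Z j * (w / 2) ^ (n * j) *
      (catalan_coeff (real n * (k + real j)) m * (u\<^sup>2 / (1 + u\<^sup>2)\<^sup>2) ^ m)" for j m
  proof -
    have "w ^ (n * j + 2 * m) / 2 ^ (n * j + 2 * m) = (w / 2) ^ (n * j) * ((w / 2)\<^sup>2) ^ m"
      by (simp add: power_divide power_add power_mult)
    moreover have "c (j, m) * w ^ d (j, m) = Z j * catalan_coeff (real n * (k + real j)) m *
        (w ^ (n * j + 2 * m) / 2 ^ (n * j + 2 * m))"
      by (simp add: c_def d_def Z_def bessel_coeff_def bessel_degree_def)
    ultimately show ?thesis
      unfolding w2[symmetric] by (simp only: mult_ac)
  qed
  have "u\<^sup>2 \<le> (1/12)\<^sup>2"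
    using u by (intro power_mono) auto
  then have inner: "((\<lambda>m. catalan_coeff (real n * (k + real j)) m * (u\<^sup>2 / (1 + u\<^sup>2)\<^sup>2) ^ m) has_sum
      (1 + u\<^sup>2) powr (real n * (k + real j))) UNIV" for j
    using n k u by (intro catalan_has_sum) (auto simp: power2_eq_square)
  have inner': "((\<lambda>m. c (j, m) * w ^ d (j, m)) has_sum (1 + u\<^sup>2) powr (real n * k) * (Z j * (u ^ n) ^ j)) UNIV" for j
  proof -
    have "Z j * (w / 2) ^ (n * j) * (1 + u\<^sup>2) powr (real n * (k + real j)) =
        (1 + u\<^sup>2) powr (real n * k) * (Z j * (u ^ n) ^ j)"
      using parametrized_power[of j] by (simp add: mult_ac)
    then show ?thesis
      unfolding eq using has_sum_cmult_right[OF inner[of j], of "Z j * (w / 2) ^ (n * j)"] by (simp only:)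
  qed
  have abs_inner: "((\<lambda>m. \<bar>c (j, m)\<bar> * w ^ d (j, m)) has_sum
      (1 + u\<^sup>2) powr (real n * k) * (\<bar>Z j\<bar> * (u ^ n) ^ j)) UNIV" for j
  proof -
    have "0 < real n * (k + real j)"
      using n k by simp
    note cat = catalan_coeff_nonneg[OF this]
    have "\<bar>c (j, m)\<bar> * w ^ d (j, m) = \<bar>c (j, m) * w ^ d (j, m)\<bar>" for m
      using w by (simp add: abs_mult)
    also have "\<bar>c (j, m) * w ^ d (j, m)\<bar> = \<bar>Z j\<bar> * (w / 2) ^ (n * j) *
      (catalan_coeff (real n * (k + real j)) m * (u\<^sup>2 / (1 + u\<^sup>2)\<^sup>2) ^ m)" for m
      unfolding eq using cat[of m] w by (simp add: abs_mult)
    finally have eq_abs: "\<bar>c (j, m)\<bar> * w ^ d (j, m) = \<bar>Z j\<bar> * (w / 2) ^ (n * j) *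
      (catalan_coeff (real n * (k + real j)) m * (u\<^sup>2 / (1 + u\<^sup>2)\<^sup>2) ^ m)" for m .
    have "\<bar>Z j\<bar> * (w / 2) ^ (n * j) * (1 + u\<^sup>2) powr (real n * (k + real j)) =
        (1 + u\<^sup>2) powr (real n * k) * (\<bar>Z j\<bar> * (u ^ n) ^ j)"
      using parametrized_power[of j] by (simp add: mult_ac)
    then show ?thesis
      unfolding eq_abs using has_sum_cmult_right[OF inner[of j], of "\<bar>Z j\<bar> * (w / 2) ^ (n * j)"] by (simp only:)
  qed
  have "(\<lambda>p. \<bar>c p\<bar> * w ^ d p) summable_on (UNIV \<times> UNIV)"
  proof (rule summable_on_SigmaI[OF abs_inner])
    show "(\<lambda>j. (1 + u\<^sup>2) powr (real n * k) * (\<bar>Z j\<bar> * (u ^ n) ^ j)) summable_on UNIV"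
      unfolding Z_def using small_power k
      by (intro summable_on_cmult_right gegenbauer_zonal_summable) auto
  qed (use w in auto)
  then show abs: "(\<lambda>p. \<bar>c p\<bar> * w ^ d p) summable_on UNIV"
    by simp
  have "(\<lambda>p. c p * w ^ d p) summable_on (UNIV \<times> UNIV)"
    by (rule abs_summable_summable) (use abs w in \<open>simp add: abs_mult\<close>)
  then have "((\<lambda>j. (1 + u\<^sup>2) powr (real n * k) * (Z j * (u ^ n) ^ j)) has_sum
      (\<Sum>\<^sub>\<infinity>p\<in>UNIV \<times> UNIV. c p * w ^ d p)) UNIV"
    by (rule has_sum_SigmaD[OF has_sum_infsum inner'])
  from infsumI[OF this] show "(\<Sum>\<^sub>\<infinity>p. c p * w ^ d p) =
    (1 + u\<^sup>2) powr (real n * k) * (\<Sum>\<^sub>\<infinity>j. Z j * (u ^ n) ^ j)"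
    by (simp add: infsum_cmult_right')
qed

text \<open>For fixed j the sum over J is the product of the 1 - w * c i raised to -(k + j), and
  that product is W / (1 + u^2)^n with W the denominator of the Poisson kernel. The value is stated
  through the zonal series, so that it coincides with that of the Bessel side.\<close>

lemma horn_coeff_has_sum:
  assumes S: "S = sin a * sin b" and nc: "a - b = real n * \<alpha>"
    and c: "\<And>i. c i = cos (\<alpha> + 2 * pi * real i / real n)"
  shows "(\<lambda>p. \<bar>horn_coeff n k S c p\<bar> * w ^ horn_degree n p) summable_on (UNIV \<times> ({1..n} \<rightarrow>\<^sub>E UNIV))"
  "(\<Sum>\<^sub>\<infinity>p\<in>UNIV \<times> ({1..n} \<rightarrow>\<^sub>E UNIV). horn_coeff n k S c p * w ^ horn_degree n p) =
    (1 + u\<^sup>2) powr (real n * k) * (\<Sum>\<^sub>\<infinity>j. gegenbauer_zonal j k a b * (u ^ n) ^ j)"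
proof -
  define h where "h = horn_coeff n k S c"
  define d where "d = horn_degree n"
  define A where "A = {1..n} \<rightarrow>\<^sub>E (UNIV :: nat set)"
  have wc: "\<bar>w * c i\<bar> \<le> w" for i
  proof -
    have "w * \<bar>c i\<bar> \<le> w * 1"
      using w by (intro mult_left_mono) (auto simp: c)
    then show ?thesis
      using w by (simp add: abs_mult)
  qed
  then have wc1: "\<bar>w * c i\<bar> < 1" for i
    using wc[of i] w by linarith
  have S1: "\<bar>S\<bar> \<le> 1"
  proof -
    have "\<bar>sin a\<bar> * \<bar>sin b\<bar> \<le> 1 * 1"
      by (intro mult_mono) auto
    then show ?thesis
      by (simp add: S abs_mult)
  qed
  have abs_eq: "\<bar>h (j, J)\<bar> * w ^ d (j, J) = kernel_weight k j * (4 * (w / 2) ^ n * \<bar>S\<bar>) ^ j *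
      (\<Prod>i=1..n. pochhammer (k + real j) (J i) / fact (J i) * \<bar>w * c i\<bar> ^ J i)" for j J
  proof -
    have "\<bar>h (j, J)\<bar> * w ^ d (j, J) = \<bar>h (j, J) * w ^ d (j, J)\<bar>"
      using w by (simp add: abs_mult)
    also have "\<dots> = kernel_weight k j * (4 * (w / 2) ^ n * \<bar>S\<bar>) ^ j *
      (\<Prod>i=1..n. pochhammer (k + real j) (J i) / fact (J i) * \<bar>w * c i\<bar> ^ J i)"
      unfolding h_def d_def horn_coeff_eq
      using kernel_weight_nonneg[OF k, of j] k w
      by (simp add: abs_mult abs_prod power_abs pochhammer_nonneg)
    finally show ?thesis .
  qed
  have abs_inner: "((\<lambda>J. \<bar>h (j, J)\<bar> * w ^ d (j, J)) has_sum kernel_weight k j * (4 * (w / 2) ^ n * \<bar>S\<bar>) ^ j *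
      (\<Prod>i=1..n. (1 - \<bar>w * c i\<bar>) powr (- (k + real j)))) A" for j
    unfolding abs_eq A_def using wc1 k
    by (intro has_sum_cmult_right prod_pochhammer_has_sum) auto
  have "(\<lambda>p. \<bar>h p\<bar> * w ^ d p) summable_on (UNIV \<times> A)"
  proof (rule summable_on_SigmaI[OF abs_inner])
    \<comment> \<open>The ratio of the majorant in j after each 1 - |w * c i| is replaced by 1 - w;
      w <= 1/12 makes it at most 4/22.\<close>
    define x where "x = 4 * (w / 2 / (1 - w)) ^ n"
    have x0: "0 \<le> w / 2 / (1 - w)" "w / 2 / (1 - w) \<le> 1/22"
      using w by (simp_all add: field_simps)
    then have "w / 2 / (1 - w) \<le> 1"
      by linarith
    then have "(w / 2 / (1 - w)) ^ n \<le> (w / 2 / (1 - w)) ^ 1"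
      using x0 n by (intro power_decreasing) auto
    then have "(w / 2 / (1 - w)) ^ n \<le> 1/22"
      using x0 by (simp only: power_one_right)
    moreover have "0 \<le> (w / 2 / (1 - w)) ^ n"
      using x0 by (intro zero_le_power) auto
    ultimately have x: "0 \<le> x" "x < 1"
      unfolding x_def by linarith+
    show "(\<lambda>j. kernel_weight k j * (4 * (w / 2) ^ n * \<bar>S\<bar>) ^ j *
      (\<Prod>i=1..n. (1 - \<bar>w * c i\<bar>) powr (- (k + real j)))) summable_on UNIV"
    proof (rule summable_on_comparison_test)
      show "(\<lambda>j. (1 - w) powr (- real n * k) * (kernel_weight k j * \<bar>x\<bar> ^ j)) summable_on UNIV"
        using x by (intro summable_on_cmult_right kernel_weight_summable k) auto
      fix j
      have "(\<Prod>i=1..n. (1 - \<bar>w * c i\<bar>) powr (- (k + real j))) \<le> (\<Prod>i=1..n. (1 - w) powr (- (k + real j)))"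
        using wc w k by (intro prod_mono conjI powr_mono2') (auto simp: less_imp_le)
      also have "\<dots> = (1 - w) powr (- (k + real j) * real n)"
        using w by (simp add: powr_powr flip: powr_realpow)
      also have "\<dots> = (1 - w) powr (- real n * k) * (1 - w) powr (- real (n * j))"
        by (simp add: algebra_simps flip: powr_add)
      also have "(1 - w) powr (- real (n * j)) = 1 / ((1 - w) ^ n) ^ j"
        using w by (simp only: powr_minus powr_realpow power_mult inverse_eq_divide)
      finally have P: "(\<Prod>i=1..n. (1 - \<bar>w * c i\<bar>) powr (- (k + real j)))
          \<le> (1 - w) powr (- real n * k) * (1 / ((1 - w) ^ n) ^ j)" .
      have "4 * (w / 2) ^ n * \<bar>S\<bar> \<le> 4 * (w / 2) ^ n * 1"
        using w S1 by (intro mult_left_mono) auto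
      then have "(4 * (w / 2) ^ n * \<bar>S\<bar>) ^ j \<le> (4 * (w / 2) ^ n) ^ j"
        using w by (intro power_mono) auto
      then have "kernel_weight k j * (4 * (w / 2) ^ n * \<bar>S\<bar>) ^ j *
          (\<Prod>i=1..n. (1 - \<bar>w * c i\<bar>) powr (- (k + real j))) \<le>
          kernel_weight k j * (4 * (w / 2) ^ n) ^ j * ((1 - w) powr (- real n * k) * (1 / ((1 - w) ^ n) ^ j))"
        using w kernel_weight_nonneg[OF k, of j]
        by (intro mult_mono[OF mult_left_mono P]) (auto intro: prod_nonneg)
      also have "\<dots> = (1 - w) powr (- real n * k) * (kernel_weight k j * \<bar>x\<bar> ^ j)"
      proof -
        have "\<bar>x\<bar> ^ j = (4 * (w / 2) ^ n) ^ j * (1 / ((1 - w) ^ n) ^ j)"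
          using x(1) by (simp only: x_def power_divide times_divide_eq_right mult_1_right abs_of_nonneg)
        then show ?thesis
          by (simp only: mult_ac)
      qed
      finally show "kernel_weight k j * (4 * (w / 2) ^ n * \<bar>S\<bar>) ^ j *
          (\<Prod>i=1..n. (1 - \<bar>w * c i\<bar>) powr (- (k + real j))) \<le>
          (1 - w) powr (- real n * k) * (kernel_weight k j * \<bar>x\<bar> ^ j)" .
      show "0 \<le> kernel_weight k j * (4 * (w / 2) ^ n * \<bar>S\<bar>) ^ j *
          (\<Prod>i=1..n. (1 - \<bar>w * c i\<bar>) powr (- (k + real j)))"
        using w kernel_weight_nonneg[OF k, of j] by (auto intro!: mult_nonneg_nonneg prod_nonneg)
    qed
  qed (use w in auto)
  then show abs: "(\<lambda>p. \<bar>h p\<bar> * w ^ d p) summable_on (UNIV \<times> A)" .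
  have "(\<lambda>p. h p * w ^ d p) summable_on (UNIV \<times> A)"
    by (rule abs_summable_summable) (use abs w in \<open>simp add: abs_mult\<close>)
  note summable = has_sum_infsum[OF this]
  define q where "q = u ^ n"
  define W where "W = 1 - 2 * q * cos (a - b) + q\<^sup>2"
  have pos: "0 < 1 + u\<^sup>2"
    by (simp add: add_pos_nonneg)
  have "(\<Prod>i=1..n. 1 - w * c i) = (\<Prod>i=1..n. (1 - 2 * u * cos (\<alpha> + 2 * pi * real i / real n) + u\<^sup>2) / (1 + u\<^sup>2))"
  proof (rule prod.cong)
    have "w * (1 + u\<^sup>2) = 2 * u"
      using wu pos by (simp add: field_simps)
    then have "(1 - w * x) * (1 + u\<^sup>2) = 1 - 2 * u * x + u\<^sup>2" for x
      by algebra
    then have "1 - w * x = (1 - 2 * u * x + u\<^sup>2) / (1 + u\<^sup>2)" for x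
      using pos by (simp add: eq_divide_eq)
    then show "1 - w * c i = (1 - 2 * u * cos (\<alpha> + 2 * pi * real i / real n) + u\<^sup>2) / (1 + u\<^sup>2)" for i
      unfolding c .
  qed simp
  also have "\<dots> = W / (1 + u\<^sup>2) ^ n"
    unfolding prod_dividef prod_one_minus_two_cos[OF n] by (simp add: W_def q_def nc)
  finally have prod_eq: "(\<Prod>i=1..n. 1 - w * c i) = W / (1 + u\<^sup>2) ^ n" .
  have inner: "((\<lambda>J. h (j, J) * w ^ d (j, J)) has_sum (1 + u\<^sup>2) powr (real n * k) *
      (kernel_weight k j * (- 4 * q * sin a * sin b) ^ j * W powr (- (k + real j)))) A" for j
  proof -
    have nonneg: "0 \<le> 1 - w * c i" for i
      using wc1[of i] by (simp add: abs_if split: if_splits)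
    then have "0 \<le> (\<Prod>i=1..n. 1 - w * c i)"
      by (intro prod_nonneg) auto
    then have W: "0 \<le> W"
      unfolding prod_eq using zero_less_power[OF pos, of n] by (auto simp: zero_le_divide_iff)
    have "(\<Prod>i=1..n. (1 - w * c i) powr (- (k + real j))) = (W / (1 + u\<^sup>2) ^ n) powr (- (k + real j))"
      using nonneg by (simp add: prod_powr_distrib flip: prod_eq)
    also have "\<dots> = (1 + u\<^sup>2) powr (real n * (k + real j)) * W powr (- (k + real j))"
    proof -
      have "((1 + u\<^sup>2) ^ n) powr (k + real j) = (1 + u\<^sup>2) powr (real n * (k + real j))"
        using pos by (simp add: powr_powr flip: powr_realpow)
      then have "((1 + u\<^sup>2) ^ n) powr (- (k + real j)) = inverse ((1 + u\<^sup>2) powr (real n * (k + real j)))"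
        by (simp only: powr_minus)
      moreover have "(W / (1 + u\<^sup>2) ^ n) powr (- (k + real j)) =
          W powr (- (k + real j)) / ((1 + u\<^sup>2) ^ n) powr (- (k + real j))"
        by (rule powr_divide)
      ultimately show ?thesis
        by (simp only: divide_inverse inverse_inverse_eq mult.commute)
    qed
    finally have P: "(\<Prod>i=1..n. (1 - w * c i) powr (- (k + real j))) =
      (1 + u\<^sup>2) powr (real n * (k + real j)) * W powr (- (k + real j))" .
    have pw: "(- 4 * (w / 2) ^ n * S) ^ j = (- 4 * S) ^ j * (w / 2) ^ (n * j)"
      "(- 4 * q * sin a * sin b) ^ j = (- 4 * S) ^ j * (u ^ n) ^ j"
    proof -
      have "- 4 * (w / 2) ^ n * S = (- 4 * S) * (w / 2) ^ n" "- 4 * q * sin a * sin b = (- 4 * S) * u ^ n"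
        by (simp_all add: S q_def)
      then show "(- 4 * (w / 2) ^ n * S) ^ j = (- 4 * S) ^ j * (w / 2) ^ (n * j)"
        "(- 4 * q * sin a * sin b) ^ j = (- 4 * S) ^ j * (u ^ n) ^ j"
        by (simp_all only: power_mult_distrib power_mult)
    qed
    have "kernel_weight k j * (- 4 * (w / 2) ^ n * S) ^ j * (\<Prod>i=1..n. (1 - w * c i) powr (- (k + real j))) =
        kernel_weight k j * (- 4 * S) ^ j *
        ((w / 2) ^ (n * j) * (1 + u\<^sup>2) powr (real n * (k + real j))) * W powr (- (k + real j))"
      unfolding P pw by (simp only: mult_ac)
    also have "\<dots> = (1 + u\<^sup>2) powr (real n * k) *
      (kernel_weight k j * (- 4 * q * sin a * sin b) ^ j * W powr (- (k + real j)))"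
      unfolding parametrized_power pw by (simp only: mult_ac)
    finally have eq: "kernel_weight k j * (- 4 * (w / 2) ^ n * S) ^ j *
        (\<Prod>i=1..n. (1 - w * c i) powr (- (k + real j))) = \<dots>" .
    show ?thesis
      unfolding h_def d_def horn_coeff_eq A_def eq[symmetric] using wc1 k
      by (intro has_sum_cmult_right prod_pochhammer_has_sum) auto
  qed
  have "(\<Sum>\<^sub>\<infinity>p\<in>UNIV \<times> A. h p * w ^ d p) = (1 + u\<^sup>2) powr (real n * k) *
      (\<Sum>\<^sub>\<infinity>j. kernel_weight k j * (- 4 * q * sin a * sin b) ^ j * W powr (- (k + real j)))"
    using infsumI[OF has_sum_SigmaD[OF summable inner]] by (simp add: infsum_cmult_right')
  also have "(\<Sum>\<^sub>\<infinity>j. kernel_weight k j * (- 4 * q * sin a * sin b) ^ j * W powr (- (k + real j))) =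
      (\<Sum>\<^sub>\<infinity>j. gegenbauer_zonal j k a b * q ^ j)"
  proof -
    have "(\<lambda>j. norm (gegenbauer_zonal j k a b * q ^ j)) summable_on UNIV"
      using gegenbauer_zonal_summable[of k q a b] k small_power by (simp add: abs_mult q_def)
    then have "(\<lambda>j. gegenbauer_zonal j k a b * q ^ j) sums (\<Sum>\<^sub>\<infinity>j. gegenbauer_zonal j k a b * q ^ j)"
      by (intro has_sum_imp_sums has_sum_infsum[OF abs_summable_summable])
    moreover have "(\<lambda>j. gegenbauer_zonal j k a b * q ^ j) sums
        (\<Sum>\<^sub>\<infinity>j. kernel_weight k j * (- 4 * q * sin a * sin b) ^ j * W powr (- (k + real j)))"
      unfolding W_def using small_power k by (intro gegenbauer_poisson_kernel) (auto simp: q_def)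
    ultimately show ?thesis
      using sums_unique2 by blast
  qed
  finally show "(\<Sum>\<^sub>\<infinity>p\<in>UNIV \<times> A. h p * w ^ d p) =
    (1 + u\<^sup>2) powr (real n * k) * (\<Sum>\<^sub>\<infinity>j. gegenbauer_zonal j k a b * (u ^ n) ^ j)"
    by (simp add: q_def)
qed

end

text \<open>\<open>wt\<close> restores the removed denominators, now with arbitrary v. The radius
  1/12 is the bound on w under which both transforms were computed.\<close>

lemma bessel_horn_identity:
  fixes v k :: real
  assumes "0 < n" "0 < k" and ab: "a - b = real n * \<alpha>"
    and c: "\<And>i. c i = cos (\<alpha> + 2 * pi * real i / real n)"
  defines "wt \<equiv> \<lambda>N. v ^ N / pochhammer (real n * k) N"
  shows "(\<lambda>p. bessel_coeff n k a b p * wt (bessel_degree n p)) summable_on UNIV"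
    "(\<lambda>N. infsum (bessel_coeff n k a b) {p \<in> UNIV. bessel_degree n p = N} * wt N) sums
      (\<Sum>\<^sub>\<infinity>p. bessel_coeff n k a b p * wt (bessel_degree n p))"
    "(\<lambda>p. horn_coeff n k (sin a * sin b) c p * wt (horn_degree n p)) summable_on
      (UNIV \<times> ({1..n} \<rightarrow>\<^sub>E UNIV))"
    "(\<Sum>\<^sub>\<infinity>p. bessel_coeff n k a b p * wt (bessel_degree n p)) =
      (\<Sum>\<^sub>\<infinity>p\<in>UNIV \<times> ({1..n} \<rightarrow>\<^sub>E UNIV). horn_coeff n k (sin a * sin b) c p * wt (horn_degree n p))"
proof -
  define \<epsilon> :: real where "\<epsilon> = 1/12"
  have "0 < \<epsilon>"
    by (simp add: \<epsilon>_def)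
  obtain K where K: "\<And>N. \<bar>wt N\<bar> \<le> K * \<epsilon> ^ N"
    unfolding wt_def using power_div_pochhammer_bounded[of "real n * k" \<epsilon> v] assms \<open>0 < \<epsilon>\<close> by auto
  obtain u where u: "0 < u" "u \<le> 1/12" "\<epsilon> / 2 = u / (1 + u\<^sup>2)"
    using rational_parametrization[of \<epsilon>] by (auto simp: \<epsilon>_def)
  have B: "(\<lambda>p. \<bar>bessel_coeff n k a b p\<bar> * \<epsilon> ^ bessel_degree n p) summable_on UNIV"
    by (rule bessel_coeff_has_sum(1)) (use assms u in \<open>auto simp: \<epsilon>_def\<close>)
  have H: "(\<lambda>p. \<bar>horn_coeff n k (sin a * sin b) c p\<bar> * \<epsilon> ^ horn_degree n p) summable_on
      (UNIV \<times> ({1..n} \<rightarrow>\<^sub>E UNIV))"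
    by (rule horn_coeff_has_sum(1)[where u = u and \<alpha> = \<alpha> and a = a and b = b])
      (use assms u in \<open>auto simp: \<epsilon>_def\<close>)
  show "(\<lambda>p. bessel_coeff n k a b p * wt (bessel_degree n p)) summable_on UNIV"
    by (rule has_sum_graded(1)[OF \<open>0 < \<epsilon>\<close> B K])
  show "(\<lambda>N. infsum (bessel_coeff n k a b) {p \<in> UNIV. bessel_degree n p = N} * wt N) sums
      (\<Sum>\<^sub>\<infinity>p. bessel_coeff n k a b p * wt (bessel_degree n p))"
    by (rule has_sum_graded(2)[OF \<open>0 < \<epsilon>\<close> B K])
  show "(\<lambda>p. horn_coeff n k (sin a * sin b) c p * wt (horn_degree n p)) summable_on
      (UNIV \<times> ({1..n} \<rightarrow>\<^sub>E UNIV))"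
    by (rule has_sum_graded(1)[OF \<open>0 < \<epsilon>\<close> H K])
  show "(\<Sum>\<^sub>\<infinity>p. bessel_coeff n k a b p * wt (bessel_degree n p)) =
      (\<Sum>\<^sub>\<infinity>p\<in>UNIV \<times> ({1..n} \<rightarrow>\<^sub>E UNIV). horn_coeff n k (sin a * sin b) c p * wt (horn_degree n p))"
  proof (rule graded_transfer[OF \<open>0 < \<epsilon>\<close> B H _ K])
    fix w assume w: "0 < w" "w < \<epsilon>"
    then obtain u where u: "0 < u" "u \<le> 1/12" "w / 2 = u / (1 + u\<^sup>2)"
      using rational_parametrization[of w] by (auto simp: \<epsilon>_def)
    have w': "0 < w" "w \<le> 1/12"
      using w by (auto simp: \<epsilon>_def)
    show "(\<Sum>\<^sub>\<infinity>p. bessel_coeff n k a b p * w ^ bessel_degree n p) =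
        (\<Sum>\<^sub>\<infinity>p\<in>UNIV \<times> ({1..n} \<rightarrow>\<^sub>E UNIV). horn_coeff n k (sin a * sin b) c p * w ^ horn_degree n p)"
      using bessel_coeff_has_sum(2)[OF assms(1,2) u(1,2) w' u(3), of a b]
        horn_coeff_has_sum(2)[OF assms(1,2) u(1,2) w' u(3) refl ab c] by simp
  qed
qed

section \<open>The generalized Bessel function\<close>

text \<open>For j >= 1 the zonal term is of order k as k -> 0, and the factor (j + k) / k
  compensates this: the limit is 2 cos (j a) cos (j b).\<close>

definition zonal_coeff :: "nat \<Rightarrow> real \<Rightarrow> real \<Rightarrow> real \<Rightarrow> real" where
  "zonal_coeff j k a b = (real j + k) / k * gegenbauer_zonal j k a b"

text \<open>\<open>bessel_I (n * j + n * k) v\<close> divided by (v / 2)^(n k + n j) / Gamma (n k +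
  1). Using the same Gamma value for all j keeps the prefactor out of the sum, and the quotient is
  regular at k = 0.\<close>

definition bessel_tail :: "nat \<Rightarrow> real \<Rightarrow> real \<Rightarrow> nat \<Rightarrow> real" where
  "bessel_tail n v k j = (\<Sum>m. (v\<^sup>2 / 4) ^ m / (fact m * pochhammer (real n * k + 1) (n * j + m)))"

text \<open>The generalized Bessel function at \<open>v = \<rho> * r\<close>, \<open>a = n * \<theta>\<close>, \<open>b = n * \<phi>\<close>, with the Gamma
  factors of the normalizing constant cancelled, so that \<open>k\<close> may tend to \<open>0\<close>.\<close>

definition normalized_series :: "nat \<Rightarrow> real \<Rightarrow> real \<Rightarrow> real \<Rightarrow> real \<Rightarrow> real" where
  "normalized_series n v a b k = (\<Sum>j. zonal_coeff j k a b * (v / 2) ^ (n * j) * bessel_tail n v k j)"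

lemma pochhammer_ge_fact:
  assumes "(1 :: real) \<le> x"
  shows "fact N \<le> pochhammer x N"
proof -
  have "pochhammer 1 N \<le> pochhammer x N"
    unfolding pochhammer_prod by (rule prod_mono) (use assms in auto)
  then show ?thesis
    by (simp add: pochhammer_fact)
qed

text \<open>The right-hand side does not involve k, so it can serve as the dominating series when k
  -> 0.\<close>

lemma bessel_tail_term_bound:
  assumes "0 \<le> k"
  shows "\<bar>(v\<^sup>2 / 4) ^ m / (fact m * pochhammer (real n * k + 1) (n * j + m))\<bar>
    \<le> (v\<^sup>2 / 4) ^ m / fact m / fact (n * j)"
proof -
  have "fact (n * j) \<le> (fact (n * j + m) :: real)"
    by (intro fact_mono) auto
  also have "\<dots> \<le> pochhammer (real n * k + 1) (n * j + m)"
    using assms by (intro pochhammer_ge_fact) simp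
  finally have le: "fact (n * j) \<le> pochhammer (real n * k + 1) (n * j + m)" .
  then have pos: "0 < pochhammer (real n * k + 1) (n * j + m)"
    using fact_gt_zero[of "n * j", where 'a = real] by linarith
  have "(v\<^sup>2 / 4) ^ m / fact m / pochhammer (real n * k + 1) (n * j + m) \<le> (v\<^sup>2 / 4) ^ m / fact m / fact (n * j)"
    using le pos by (intro divide_left_mono) auto
  then show ?thesis
    using pos by (simp add: abs_mult abs_divide)
qed

lemma summable_power_div_fact: "summable (\<lambda>m. (x :: real) ^ m / fact m)"
  using summable_exp[of x] by (simp add: field_simps)

lemma bessel_tail_has_sum:
  assumes "0 \<le> k"
  shows "((\<lambda>m. (v\<^sup>2 / 4) ^ m / (fact m * pochhammer (real n * k + 1) (n * j + m))) has_sum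
    bessel_tail n v k j) UNIV"
proof -
  define f where "f m = (v\<^sup>2 / 4) ^ m / (fact m * pochhammer (real n * k + 1) (n * j + m))" for m
  have "summable (\<lambda>m. norm (f m))"
  proof (rule summable_comparison_test[OF exI])
    show "\<forall>m\<ge>0. norm (norm (f m)) \<le> (v\<^sup>2 / 4) ^ m / fact m / fact (n * j)"
      using bessel_tail_term_bound[OF assms, of v _ n j] by (simp add: f_def)
    show "summable (\<lambda>m. (v\<^sup>2 / 4) ^ m / fact m / fact (n * j))"
      by (intro summable_divide summable_power_div_fact)
  qed
  from norm_summable_imp_has_sum[OF this summable_sums[OF summable_norm_cancel[OF this]]]
  show ?thesis
    by (simp only: bessel_tail_def f_def)
qed

lemma bessel_tail_bound:
  assumes "0 \<le> k"
  shows "\<bar>bessel_tail n v k j\<bar> \<le> exp (v\<^sup>2 / 4) / fact (n * j)"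
proof -
  have sums: "(\<lambda>m. (v\<^sup>2 / 4) ^ m / fact m / fact (n * j)) sums (exp (v\<^sup>2 / 4) / fact (n * j))"
    using exp_converges[of "v\<^sup>2 / 4"] by (intro sums_divide) (simp add: field_simps scaleR_conv_of_real)
  have "norm (bessel_tail n v k j) \<le> (\<Sum>m. (v\<^sup>2 / 4) ^ m / fact m / fact (n * j))"
    unfolding bessel_tail_def
    by (rule norm_suminf_le[OF _ sums_summable[OF sums]])
      (unfold real_norm_def, rule bessel_tail_term_bound[OF assms])
  also have "\<dots> = exp (v\<^sup>2 / 4) / fact (n * j)"
    by (rule sums_unique[symmetric, OF sums])
  finally show ?thesis
    by simp
qed

text \<open>Splitting (n k)_(n j + 2 m) after n j factors cancels the numerator of
  \<open>catalan_coeff\<close>. This is where the Catalan coefficients in the transform of a Bessel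
  function come from.\<close>

lemma bessel_coeff_weighted:
  assumes "0 < n" "0 < k"
  shows "bessel_coeff n k a b (j, m) *
      (v ^ bessel_degree n (j, m) / pochhammer (real n * k) (bessel_degree n (j, m))) =
    zonal_coeff j k a b * (v / 2) ^ (n * j) *
      ((v\<^sup>2 / 4) ^ m / (fact m * pochhammer (real n * k + 1) (n * j + m)))"
proof -
  define \<mu> where "\<mu> = real n * k"
  define \<nu> where "\<nu> = \<mu> + real (n * j)"
  have pos: "0 < \<mu>" "0 < \<nu>"
    using assms by (simp_all add: \<mu>_def \<nu>_def add_pos_nonneg)
  define P where "P = pochhammer \<mu> (n * j)"
  define Q where "Q = pochhammer (\<mu> + 1) (n * j)"
  define R where "R = pochhammer \<nu> (2 * m)"
  define S where "S = pochhammer (\<nu> + 1) m"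
  \<comment> \<open>The product (\<mu>)_(n j + 1), with its last or its first factor taken out. The
    ratio \<nu> / \<mu> becomes the (j + k) / k of \<open>zonal_coeff\<close>.\<close>
  have PQ: "P * \<nu> = \<mu> * Q"
    using pochhammer_Suc[of \<mu> "n * j"] pochhammer_rec[of \<mu> "n * j"]
    by (simp add: P_def Q_def \<nu>_def)
  have 1: "pochhammer \<mu> (n * j + 2 * m) = P * R"
    unfolding P_def R_def \<nu>_def by (rule pochhammer_product')
  have 2: "pochhammer (\<mu> + 1) (n * j + m) = Q * S"
    using pochhammer_product'[of "\<mu> + 1" "n * j" m] by (simp add: Q_def S_def \<nu>_def add_ac)
  have gt: "0 < P" "0 < Q" "0 < R" "0 < S"
    using pos by (auto simp: P_def Q_def R_def S_def intro!: pochhammer_pos)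
  have "v ^ (n * j + 2 * m) / 2 ^ (n * j + 2 * m) = (v / 2) ^ (n * j) * ((v / 2)\<^sup>2) ^ m"
    by (simp add: power_divide power_add power_mult)
  then have V: "v ^ (n * j + 2 * m) / 2 ^ (n * j + 2 * m) = (v / 2) ^ (n * j) * (v\<^sup>2 / 4) ^ m"
    by (simp add: power_divide)
  have \<nu>: "real n * (k + real j) = \<nu>" "(real j + k) / k = \<nu> / \<mu>"
    using assms by (simp_all add: \<nu>_def \<mu>_def field_simps)
  have "bessel_coeff n k a b (j, m) *
      (v ^ bessel_degree n (j, m) / pochhammer \<mu> (bessel_degree n (j, m))) =
     gegenbauer_zonal j k a b * (v ^ (n * j + 2 * m) / 2 ^ (n * j + 2 * m)) * (R / (fact m * S) / (P * R))"
    by (simp add: bessel_coeff_def bessel_degree_def catalan_coeff_def \<nu> 1 R_def S_def)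
  also have "R / (fact m * S) / (P * R) = \<nu> / \<mu> * (1 / (fact m * (Q * S)))"
    using PQ gt pos by (simp add: divide_simps) (simp add: mult_ac)
  finally show ?thesis
    unfolding V zonal_coeff_def \<nu> \<mu>_def[symmetric] 2 by simp
qed

lemma normalized_series_sums:
  assumes "0 < n" "0 < k"
  shows "(\<lambda>j. zonal_coeff j k a b * (v / 2) ^ (n * j) * bessel_tail n v k j) sums
    (\<Sum>\<^sub>\<infinity>p. bessel_coeff n k a b p *
      (v ^ bessel_degree n p / pochhammer (real n * k) (bessel_degree n p)))"
proof -
  define f where "f p = bessel_coeff n k a b p *
      (v ^ bessel_degree n p / pochhammer (real n * k) (bessel_degree n p))" for p
  \<comment> \<open>Only the Bessel half of \<open>bessel_horn_identity\<close> is wanted here, so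
    its angle \<alpha> is merely solved for.\<close>
  have "a - b = real n * ((a - b) / real n)"
    using assms by simp
  from bessel_horn_identity(1)[OF assms this refl, of v]
  have "f summable_on UNIV"
    unfolding f_def .
  then have "(f has_sum infsum f UNIV) (UNIV \<times> UNIV)"
    unfolding UNIV_Times_UNIV by (rule has_sum_infsum)
  then have "((\<lambda>j. zonal_coeff j k a b * (v / 2) ^ (n * j) * bessel_tail n v k j) has_sum infsum f UNIV) UNIV"
  proof (rule has_sum_SigmaD)
    fix j
    show "((\<lambda>m. f (j, m)) has_sum zonal_coeff j k a b * (v / 2) ^ (n * j) * bessel_tail n v k j) UNIV"
      unfolding f_def bessel_coeff_weighted[OF assms]
      by (intro has_sum_cmult_right bessel_tail_has_sum) (use assms in auto)
  qed
  then show ?thesis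
    unfolding f_def by (rule has_sum_imp_sums)
qed

lemma normalized_series_eq:
  assumes "0 < n" "0 < k"
  shows "normalized_series n v a b k = (\<Sum>\<^sub>\<infinity>p. bessel_coeff n k a b p *
      (v ^ bessel_degree n p / pochhammer (real n * k) (bessel_degree n p)))"
  unfolding normalized_series_def using normalized_series_sums[OF assms] by (rule sums_unique[symmetric])

text \<open>In the power series in v, only the index pair (0, 0) has degree 0. The limit fixes the
  normalizing constant; the value at v = 0 covers x = 0 or y = 0.\<close>

lemma normalized_series_tendsto:
  assumes "0 < n" "0 < k"
  shows "((\<lambda>v. normalized_series n v a b k) \<longlongrightarrow> 1) (at 0)"
    and "normalized_series n 0 a b k = 1"
proof -
  have ab: "a - b = real n * ((a - b) / real n)"
    using assms by simp
  define F where "F N = infsum (bessel_coeff n k a b) {p \<in> UNIV. bessel_degree n p = N} / pochhammer (real n * k) N" for N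
  have sums: "(\<lambda>N. F N * v ^ N) sums normalized_series n v a b k" for v
    using bessel_horn_identity(2)[OF assms ab refl, of v]
    by (simp add: normalized_series_eq[OF assms] F_def)
  have "{p \<in> UNIV. bessel_degree n p = 0} = {(0, 0)}"
    using assms by (auto simp: bessel_degree_def)
  then have F0: "F 0 = 1"
    by (simp add: F_def bessel_coeff_def catalan_coeff_def gegenbauer_zonal_def)
  show "((\<lambda>v. normalized_series n v a b k) \<longlongrightarrow> 1) (at 0)"
    using powser_limit_0[where s = 1 and a = F, OF _ sums] F0 by simp
  show "normalized_series n 0 a b k = 1"
    using sums_unique2[OF sums[of 0] powser_sums_zero] F0 by simp
qed

section \<open>The Bessel series and its normalizing constant\<close>

lemma dihedral_series_eq:
  assumes "0 < n" "0 < k" "0 < v"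
  shows "dihedral_series n k v \<phi> \<theta> = normalized_series n v (real n * \<theta>) (real n * \<phi>) k
    / (real n * Beta (k + 1/2) (1/2) * Gamma (real n * k))"
proof -
  define \<mu> where "\<mu> = real n * k"
  have \<mu>: "0 < \<mu>"
    using assms by (simp add: \<mu>_def)
  have bessel: "bessel_I (real n * real j + \<mu>) v =
      (v / 2) powr \<mu> / Gamma (\<mu> + 1) * ((v / 2) ^ (n * j) * bessel_tail n v k j)" for j
  proof -
    have "1 / (fact m * Gamma (real n * real j + \<mu> + real m + 1)) * (v / 2) powr (2 * real m + (real n * real j + \<mu>)) =
      (v / 2) powr \<mu> / Gamma (\<mu> + 1) * (v / 2) ^ (n * j) *
        ((v\<^sup>2 / 4) ^ m / (fact m * pochhammer (\<mu> + 1) (n * j + m)))" for m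
    proof -
      have "(v / 2) powr (2 * real m + (real n * real j + \<mu>)) =
          (v / 2) powr \<mu> * ((v / 2) powr real (n * j) * (v / 2) powr real (2 * m))"
        by (simp add: add_ac flip: powr_add)
      also have "\<dots> = (v / 2) powr \<mu> * ((v / 2) ^ (n * j) * ((v / 2)\<^sup>2) ^ m)"
        using assms by (simp only: powr_realpow power_mult half_gt_zero)
      finally have 1: "(v / 2) powr (2 * real m + (real n * real j + \<mu>)) =
          (v / 2) powr \<mu> * ((v / 2) ^ (n * j) * (v\<^sup>2 / 4) ^ m)"
        by (simp add: power_divide)
      have "\<mu> + 1 \<notin> \<int>\<^sub>\<le>\<^sub>0"
        using \<mu> by (auto elim!: nonpos_Ints_cases)
      then have "pochhammer (\<mu> + 1) (n * j + m) = Gamma (\<mu> + 1 + real (n * j + m)) / Gamma (\<mu> + 1)"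
        by (rule pochhammer_Gamma)
      moreover have "\<mu> + 1 + real (n * j + m) = real n * real j + \<mu> + real m + 1"
        by simp
      ultimately have "pochhammer (\<mu> + 1) (n * j + m) =
          Gamma (real n * real j + \<mu> + real m + 1) / Gamma (\<mu> + 1)"
        by (simp only:)
      moreover have "0 < Gamma (\<mu> + 1)" "0 < Gamma (real n * real j + \<mu> + real m + 1)"
        using \<mu> by (auto intro!: add_pos_nonneg add_nonneg_pos)
      ultimately show ?thesis
        unfolding 1 by simp
    qed
    then have "bessel_I (real n * real j + \<mu>) v = (\<Sum>m. (v / 2) powr \<mu> / Gamma (\<mu> + 1) * (v / 2) ^ (n * j) *
        ((v\<^sup>2 / 4) ^ m / (fact m * pochhammer (\<mu> + 1) (n * j + m))))"
      unfolding bessel_I_def by simp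
    also have "\<dots> = (v / 2) powr \<mu> / Gamma (\<mu> + 1) * (v / 2) ^ (n * j) * bessel_tail n v k j"
      using bessel_tail_has_sum[of k v n j, THEN has_sum_imp_sums] assms
      unfolding \<mu>_def by (intro sums_unique[symmetric] sums_mult) auto
    finally show ?thesis
      by simp
  qed
  define C where "C = (v / 2) powr \<mu> / Gamma (\<mu> + 1) * k"
  have "bessel_I (real n * real j + real n * k) v * (real j + k) *
        (gegenbauer j k (cos (real n * \<phi>)) * gegenbauer j k (cos (real n * \<theta>)) / gegenbauer j k 1) =
      C * (zonal_coeff j k (real n * \<theta>) (real n * \<phi>) * (v / 2) ^ (n * j) * bessel_tail n v k j)" for j
    unfolding \<mu>_def[symmetric] bessel using assms
    by (simp add: C_def zonal_coeff_def gegenbauer_zonal_def mult_ac)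
  then have "dihedral_series n k v \<phi> \<theta> = 1 / Beta (k + 1/2) (1/2) * (2 / v) powr \<mu> *
     (\<Sum>j. C * (zonal_coeff j k (real n * \<theta>) (real n * \<phi>) * (v / 2) ^ (n * j) * bessel_tail n v k j))"
    unfolding dihedral_series_def \<mu>_def by simp
  also have "(\<Sum>j. C * (zonal_coeff j k (real n * \<theta>) (real n * \<phi>) * (v / 2) ^ (n * j) * bessel_tail n v k j)) =
      C * normalized_series n v (real n * \<theta>) (real n * \<phi>) k"
    unfolding normalized_series_eq[OF assms(1,2)]
    by (intro sums_unique[symmetric] sums_mult normalized_series_sums assms)
  also have "1 / Beta (k + 1/2) (1/2) * (2 / v) powr \<mu> * (C * normalized_series n v (real n * \<theta>) (real n * \<phi>) k) =
      ((2 / v) powr \<mu> * (v / 2) powr \<mu>) * (k / Gamma (\<mu> + 1)) / Beta (k + 1/2) (1/2) *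
      normalized_series n v (real n * \<theta>) (real n * \<phi>) k"
    by (simp add: C_def mult_ac)
  also have "(2 / v) powr \<mu> * (v / 2) powr \<mu> = 1"
    using assms by (simp flip: powr_mult)
  \<comment> \<open>The k pulled out of j + k meets Gamma (n k + 1) = n k Gamma (n k); hence the
    factor n Gamma (n k) of the constant.\<close>
  also have "k / Gamma (\<mu> + 1) = 1 / (real n * Gamma \<mu>)"
  proof -
    have "\<mu> \<notin> \<int>\<^sub>\<le>\<^sub>0"
      using \<mu> by (auto elim!: nonpos_Ints_cases)
    then have "Gamma (\<mu> + 1) = real n * k * Gamma \<mu>"
      by (simp add: Gamma_plus1 \<mu>_def)
    then show ?thesis
      using assms by simp
  qed
  finally show ?thesis
    by (simp add: \<mu>_def mult_ac)
qed

lemma dihedral_normalization_pos: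
  assumes "0 < n" "0 < k"
  shows "0 < real n * Beta (k + 1/2) (1/2) * Gamma (real n * k)"
proof -
  have "0 < Gamma (k + 1/2)" "0 < Gamma (1/2 :: real)" "0 < Gamma (k + 1/2 + 1/2)" "0 < Gamma (real n * k)"
    using assms by (auto intro!: Gamma_real_pos)
  then show ?thesis
    using assms by (simp add: Beta_def)
qed

lemma dihedral_series_tendsto:
  assumes "0 < n" "0 < k"
  shows "((\<lambda>v. dihedral_series n k v \<phi> \<theta>) \<longlongrightarrow>
    1 / (real n * Beta (k + 1/2) (1/2) * Gamma (real n * k))) (at_right 0)"
proof (rule Lim_transform_eventually)
  show "((\<lambda>v. normalized_series n v (real n * \<theta>) (real n * \<phi>) k
    / (real n * Beta (k + 1/2) (1/2) * Gamma (real n * k))) \<longlongrightarrow>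
    1 / (real n * Beta (k + 1/2) (1/2) * Gamma (real n * k))) (at_right 0)"
    by (rule tendsto_divide[OF filterlim_mono[OF normalized_series_tendsto(1)[OF assms]] tendsto_const])
      (use dihedral_normalization_pos[OF assms] assms in \<open>auto intro: at_le\<close>)
  show "\<forall>\<^sub>F v in at_right 0. normalized_series n v (real n * \<theta>) (real n * \<phi>) k
    / (real n * Beta (k + 1/2) (1/2) * Gamma (real n * k)) = dihedral_series n k v \<phi> \<theta>"
    using eventually_at_right_less[of 0]
    by eventually_elim (simp add: dihedral_series_eq[OF assms])
qed

lemma dihedral_bessel_unnormalized_at_0:
  assumes "0 < n" "0 < k" "x = 0 \<or> y = 0"
  shows "dihedral_bessel_unnormalized n k x y = 1 / (real n * Beta (k + 1/2) (1/2) * Gamma (real n * k))"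
  using assms tendsto_Lim[OF _ dihedral_series_tendsto[OF assms(1,2)]]
  by (simp add: dihedral_bessel_unnormalized_def trivial_limit_at_right_real)

lemma dihedral_const_eq:
  assumes "0 < n" "0 < k"
  shows "dihedral_const n k = real n * Beta (k + 1/2) (1/2) * Gamma (real n * k)"
proof -
  define K where "K = real n * Beta (k + 1/2) (1/2) * Gamma (real n * k)"
  have K: "0 < K"
    unfolding K_def by (rule dihedral_normalization_pos[OF assms])
  \<comment> \<open>Uniqueness under \<open>THE\<close> needs a point of the closed wedge; the value
    at x = 0 is the same for all of them.\<close>
  have "rcis 1 (pi / (2 * real n)) \<in> dihedral_wedge n"
    unfolding dihedral_wedge_def using assms
    by (intro CollectI exI[of _ 1] exI[of _ "pi / (2 * real n)"]) (auto simp: field_simps)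
  then have "rcis 1 (pi / (2 * real n)) \<in> closure (dihedral_wedge n)"
    using closure_subset by blast
  then show ?thesis
    unfolding dihedral_const_def
    by (intro the_equality) (use K in \<open>auto simp: dihedral_bessel_unnormalized_at_0[OF assms] simp flip: K_def\<close>)
qed

text \<open>The definition reads angles off with \<open>Arg\<close>, whereas the theorem admits any
  polar angle. The two differ by a multiple of 2 pi, which the integer factor n preserves.\<close>

lemma cos_mult_arg:
  assumes "0 < \<rho>" "x = rcis \<rho> \<phi>"
  shows "cos (real n * Arg x) = cos (real n * \<phi>)"
proof -
  have "x \<noteq> 0"
    using assms by simp
  then have "cis (Arg x) = cis \<phi>"
    using assms by (simp add: cis_Arg sgn_eq rcis_def norm_mult)
  then have "cis (Arg x) ^ n = cis \<phi> ^ n"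
    by simp
  then show ?thesis
    by (simp add: Complex.DeMoivre complex_eq_iff)
qed

lemma dihedral_normalized_bessel_eq:
  assumes "0 < n" "0 < k" "0 \<le> \<rho>" "x = rcis \<rho> \<phi>" "0 \<le> r" "y = rcis r \<theta>"
  shows "dihedral_const n k * dihedral_bessel_unnormalized n k x y =
    normalized_series n (\<rho> * r) (real n * \<theta>) (real n * \<phi>) k"
proof (cases "x = 0 \<or> y = 0")
  case True
  then have "\<rho> * r = 0"
    using assms by auto
  moreover have "real n * Beta (k + 1/2) (1/2) * Gamma (real n * k) \<noteq> 0"
    using dihedral_normalization_pos[OF assms(1,2)] by (rule less_imp_neq[symmetric])
  moreover have "K * (1 / K) = 1" if "K \<noteq> 0" for K :: real
    using that by simp
  ultimately show ?thesis
    by (simp only: dihedral_const_eq[OF assms(1,2)] dihedral_bessel_unnormalized_at_0[OF assms(1,2) True]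
        normalized_series_tendsto(2)[OF assms(1,2)])
next
  case False
  then have "\<rho> \<noteq> 0" "r \<noteq> 0"
    using assms(4,6) by auto
  then have pos: "0 < \<rho>" "0 < r"
    using assms(3,5) by simp_all
  have "dihedral_bessel_unnormalized n k x y = dihedral_series n k (\<rho> * r) (Arg x) (Arg y)"
    using False pos assms by (simp add: dihedral_bessel_unnormalized_def)
  also have "\<dots> = dihedral_series n k (\<rho> * r) \<phi> \<theta>"
    by (simp add: dihedral_series_def cos_mult_arg[OF pos(1) assms(4)] cos_mult_arg[OF pos(2) assms(6)])
  also have "\<dots> = normalized_series n (\<rho> * r) (real n * \<theta>) (real n * \<phi>) k
    / (real n * Beta (k + 1/2) (1/2) * Gamma (real n * k))"
    by (rule dihedral_series_eq) (use assms pos in auto)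
  finally have "dihedral_bessel_unnormalized n k x y = \<dots>" .
  moreover have "K * (S / K) = S" if "0 < K" for K S :: real
    using that by simp
  ultimately show ?thesis
    using dihedral_normalization_pos[OF assms(1,2)] by (simp only: dihedral_const_eq[OF assms(1,2)])
qed

section \<open>The limit as k tends to 0\<close>

lemma gegenbauer_div_tendsto: "\<exists>l. ((\<lambda>k. gegenbauer (Suc j) k t / k) \<longlongrightarrow> l) (at_right 0)"
proof (induction j rule: less_induct)
  case (less j)
  have nz: "\<forall>\<^sub>F k in at_right (0 :: real). k \<noteq> 0"
    using eventually_at_right_less[of "0 :: real"] by eventually_elim auto
  show ?case
  proof (cases j)
    case 0
    have "((\<lambda>k. 2 * t) \<longlongrightarrow> 2 * t) (at_right (0 :: real))"
      by (rule tendsto_const)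
    moreover have "\<forall>\<^sub>F k in at_right (0 :: real). 2 * t = gegenbauer (Suc j) k t / k"
      using nz by eventually_elim (simp add: 0)
    ultimately show ?thesis
      by (intro exI) (rule Lim_transform_eventually)
  next
    case (Suc i)
    then obtain l where l: "((\<lambda>k. gegenbauer (Suc i) k t / k) \<longlongrightarrow> l) (at_right 0)"
      using less[of i] by auto
    have "\<exists>l'. ((\<lambda>k. (real i + 2 * k) * gegenbauer i k t / k) \<longlongrightarrow> l') (at_right 0)"
    \<comment> \<open>For i = 0 the quotient \<open>gegenbauer 0 k t / k\<close> diverges, but its
      coefficient is then 2 k; hence the product is treated as a whole.\<close>
    proof (cases i)
      case 0
      have "((\<lambda>k. 2) \<longlongrightarrow> (2 :: real)) (at_right (0 :: real))"
        by (rule tendsto_const)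
      moreover have "\<forall>\<^sub>F k in at_right (0 :: real). 2 = (real i + 2 * k) * gegenbauer i k t / k"
        using nz by eventually_elim (simp add: 0)
      ultimately show ?thesis
        by (intro exI) (rule Lim_transform_eventually)
    next
      case (Suc i')
      then obtain l' where l': "((\<lambda>k. gegenbauer i k t / k) \<longlongrightarrow> l') (at_right 0)"
        using less[of i'] \<open>j = Suc i\<close> by auto
      have "((\<lambda>k. (real i + 2 * k) * (gegenbauer i k t / k)) \<longlongrightarrow> (real i + 2 * 0) * l') (at_right 0)"
        by (intro tendsto_intros l')
      then show ?thesis
        by auto
    qed
    then obtain l' where l': "((\<lambda>k. (real i + 2 * k) * gegenbauer i k t / k) \<longlongrightarrow> l') (at_right 0)"
      by blast
    have "((\<lambda>k. (2 * (real i + 1 + k) * t * (gegenbauer (Suc i) k t / k)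
        - (real i + 2 * k) * gegenbauer i k t / k) / (real i + 2)) \<longlongrightarrow>
        (2 * (real i + 1 + 0) * t * l - l') / (real i + 2)) (at_right 0)"
      by (intro tendsto_intros l l') auto
    also have "(\<lambda>k. (2 * (real i + 1 + k) * t * (gegenbauer (Suc i) k t / k)
        - (real i + 2 * k) * gegenbauer i k t / k) / (real i + 2)) = (\<lambda>k. gegenbauer (Suc j) k t / k)"
      by (simp add: Suc fun_eq_iff diff_divide_distrib mult_ac)
    finally show ?thesis
      by blast
  qed
qed

text \<open>Mere existence of the limit would not do here: it stands in a denominator in
  \<open>zonal_coeff_tendsto\<close> and must be nonzero.\<close>

lemma gegenbauer_at_1_div_tendsto:
  "((\<lambda>k. gegenbauer (Suc j) k 1 / k) \<longlongrightarrow> 2 * fact j / fact (Suc j)) (at_right 0)"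
proof (rule Lim_transform_eventually)
  have "isCont (\<lambda>k :: real. 2 * pochhammer (2 * k + 1) j / fact (Suc j)) 0"
    by (intro continuous_intros isCont_o2[OF _ isCont_pochhammer]) auto
  then have "((\<lambda>k :: real. 2 * pochhammer (2 * k + 1) j / fact (Suc j)) \<longlongrightarrow>
      2 * pochhammer (2 * 0 + 1) j / fact (Suc j)) (at 0)"
    by (simp only: isCont_def)
  then show "((\<lambda>k :: real. 2 * pochhammer (2 * k + 1) j / fact (Suc j)) \<longlongrightarrow> 2 * fact j / fact (Suc j)) (at_right 0)"
    by (rule filterlim_mono) (auto simp: pochhammer_fact intro: at_le)
  show "\<forall>\<^sub>F k in at_right 0. 2 * pochhammer (2 * k + 1) j / fact (Suc j) = gegenbauer (Suc j) k 1 / k"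
    using eventually_at_right_less[of "0 :: real"]
    by eventually_elim (simp add: gegenbauer_at_1 pochhammer_rec del: gegenbauer.simps)
qed

text \<open>For j >= 1 the two numerators vanish like k, while \<open>gegenbauer j k 1\<close> and
  the k in (j + k) / k supply two such factors below.\<close>

lemma zonal_coeff_tendsto: "\<exists>l. ((\<lambda>k. zonal_coeff j k a b) \<longlongrightarrow> l) (at_right 0)"
proof (cases j)
  case 0
  have "((\<lambda>k. 1) \<longlongrightarrow> (1 :: real)) (at_right (0 :: real))"
    by (rule tendsto_const)
  moreover have "\<forall>\<^sub>F k in at_right (0 :: real). 1 = zonal_coeff j k a b"
    using eventually_at_right_less[of "0 :: real"]
    by eventually_elim (simp add: 0 zonal_coeff_def gegenbauer_zonal_def)
  ultimately show ?thesis
    by (intro exI) (rule Lim_transform_eventually)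
next
  case (Suc i)
  obtain la lb where l: "((\<lambda>k. gegenbauer j k (cos a) / k) \<longlongrightarrow> la) (at_right 0)"
      "((\<lambda>k. gegenbauer j k (cos b) / k) \<longlongrightarrow> lb) (at_right 0)"
    using gegenbauer_div_tendsto Suc by metis
  have l1: "((\<lambda>k. gegenbauer j k 1 / k) \<longlongrightarrow> 2 * fact i / fact j) (at_right 0)"
    unfolding Suc by (rule gegenbauer_at_1_div_tendsto)
  have "((\<lambda>k. (real j + k) * ((gegenbauer j k (cos a) / k) * (gegenbauer j k (cos b) / k)
      / (gegenbauer j k 1 / k))) \<longlongrightarrow> (real j + 0) * (la * lb / (2 * fact i / fact j))) (at_right 0)"
    by (intro tendsto_mult tendsto_divide[OF tendsto_mult[OF l] l1] tendsto_intros) auto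
  moreover have "\<forall>\<^sub>F k in at_right (0 :: real). (real j + k) * ((gegenbauer j k (cos a) / k) *
      (gegenbauer j k (cos b) / k) / (gegenbauer j k 1 / k)) = zonal_coeff j k a b"
    using eventually_at_right_less[of "0 :: real"]
    by eventually_elim (simp add: zonal_coeff_def gegenbauer_zonal_def)
  ultimately show ?thesis
    by (intro exI) (rule Lim_transform_eventually)
qed

text \<open>(2k)_j contains the factor 2 k, which cancels the 1 / k, and k <= 1/2 bounds the
  remaining factors by j!. The bound is therefore uniform in k.\<close>

lemma zonal_coeff_bound:
  assumes "0 < k" "k \<le> 1/2"
  shows "\<bar>zonal_coeff j k a b\<bar> \<le> 2 * (real j + 1) * 9 ^ j"
proof (cases j)
  case 0
  then show ?thesis
    using assms by (simp add: zonal_coeff_def gegenbauer_zonal_def)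
next
  case (Suc i)
  have "pochhammer (2 * k + 1) i \<le> pochhammer 2 i"
    unfolding pochhammer_prod by (rule prod_mono) (use assms in auto)
  also have "pochhammer 2 i = (fact j :: real)"
    using pochhammer_rec[of "1 :: real" i] by (simp add: Suc pochhammer_fact)
  finally have "pochhammer (2 * k) j / fact j \<le> 2 * k"
    using assms by (simp add: Suc pochhammer_rec divide_le_eq)
  then have "9 ^ j * (pochhammer (2 * k) j / fact j) \<le> 9 ^ j * (2 * k)"
    by (intro mult_left_mono) auto
  with gegenbauer_zonal_bound[OF assms(1), of j a b]
  have "\<bar>gegenbauer_zonal j k a b\<bar> \<le> 9 ^ j * (2 * k)"
    by simp
  then have "(real j + k) / k * \<bar>gegenbauer_zonal j k a b\<bar> \<le> (real j + k) / k * (9 ^ j * (2 * k))"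
    by (rule mult_left_mono) (use assms in auto)
  also have "\<dots> = 2 * (real j + k) * 9 ^ j"
    using assms by simp
  also have "\<dots> \<le> 2 * (real j + 1) * 9 ^ j"
    using assms by simp
  finally show ?thesis
    using assms by (simp add: zonal_coeff_def abs_mult)
qed

lemma bessel_tail_tendsto:
  "((\<lambda>k. bessel_tail n v k j) \<longlongrightarrow> bessel_tail n v 0 j) (at_right 0)"
proof -
  define f where "f m k = (v\<^sup>2 / 4) ^ m / (fact m * pochhammer (real n * k + 1) (n * j + m))" for m k
  have "((\<lambda>k. \<Sum>m. f m k) \<longlongrightarrow> (\<Sum>m. f m 0)) (at_right 0)"
  proof (rule tannerys_theorem[THEN conjunct2, THEN conjunct2])
    fix m
    have "isCont (f m) 0"
      unfolding f_def
      by (intro continuous_intros isCont_o2[OF _ isCont_pochhammer]) (auto simp: pochhammer_fact[symmetric])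
    then show "(f m \<longlongrightarrow> f m 0) (at_right 0)"
      unfolding isCont_def by (rule filterlim_mono) (auto intro: at_le)
  next
    have "\<forall>\<^sub>F p in at_top \<times>\<^sub>F at_right (0 :: real). True \<and> 0 < snd p"
      by (rule eventually_prodI) (simp_all add: eventually_at_right_less)
    then show "\<forall>\<^sub>F (m, k) in at_top \<times>\<^sub>F at_right 0. norm (f m k) \<le> (v\<^sup>2 / 4) ^ m / fact m / fact (n * j)"
      by eventually_elim (use bessel_tail_term_bound[of _ v _ n j] in \<open>auto simp: f_def\<close>)
    show "summable (\<lambda>m. (v\<^sup>2 / 4) ^ m / fact m / fact (n * j))"
      by (intro summable_divide summable_power_div_fact)
  qed simp
  then show ?thesis
    by (simp add: bessel_tail_def f_def)
qed

text \<open>Existence is enough: at k = 0 the theorem equates limits of functions that agree with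
  this one for positive k.\<close>

lemma normalized_series_converges_at_0:
  assumes "0 < n" "0 \<le> v"
  shows "\<exists>l. ((\<lambda>k. normalized_series n v a b k) \<longlongrightarrow> l) (at_right 0)"
proof -
  define f where "f j k = zonal_coeff j k a b * (v / 2) ^ (n * j) * bessel_tail n v k j" for j k
  \<comment> \<open>18 is 2 * 9, from j + 1 <= 2^j and the 9^j of \<open>zonal_coeff_bound\<close>;
    the factorial ensures convergence for every v.\<close>
  define M where "M j = 2 * exp (v\<^sup>2 / 4) * ((18 * (v / 2) ^ n) ^ j / fact j)" for j
  have "\<forall>j. \<exists>l. ((\<lambda>k. zonal_coeff j k a b) \<longlongrightarrow> l) (at_right 0)"
    by (intro allI zonal_coeff_tendsto)
  from choice[OF this] obtain l where l: "\<And>j. ((\<lambda>k. zonal_coeff j k a b) \<longlongrightarrow> l j) (at_right 0)"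
    by auto
  have bound: "norm (f j k) \<le> M j" if k: "0 < k" "k < 1/2" for j k
  proof -
    have "real j + 1 \<le> 2 ^ j"
      using Bernoulli_inequality[of "1 :: real" j] by simp
    have "fact j \<le> (fact (n * j) :: real)"
      using assms by (intro fact_mono) auto
    then have "exp (v\<^sup>2 / 4) / fact (n * j) \<le> exp (v\<^sup>2 / 4) / fact j"
      by (intro divide_left_mono) auto
    then have T: "\<bar>bessel_tail n v k j\<bar> \<le> exp (v\<^sup>2 / 4) / fact j"
      using bessel_tail_bound[of k n v j] k by linarith
    have "\<bar>zonal_coeff j k a b\<bar> \<le> 2 * (real j + 1) * 9 ^ j"
      using zonal_coeff_bound[of k j a b] k by simp
    also have "\<dots> \<le> 2 * 2 ^ j * 9 ^ j"
      using \<open>real j + 1 \<le> 2 ^ j\<close> by simp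
    also have "\<dots> = 2 * (2 * 9) ^ j"
      by (simp only: power_mult_distrib mult.assoc)
    finally have Z: "\<bar>zonal_coeff j k a b\<bar> \<le> 2 * 18 ^ j"
      by simp
    have "norm (f j k) = \<bar>zonal_coeff j k a b\<bar> * (v / 2) ^ (n * j) * \<bar>bessel_tail n v k j\<bar>"
      using assms by (simp add: f_def abs_mult)
    also have "\<dots> \<le> 2 * 18 ^ j * (v / 2) ^ (n * j) * (exp (v\<^sup>2 / 4) / fact j)"
      using assms by (intro mult_mono Z T) auto
    also have "\<dots> = M j"
      by (simp add: M_def power_mult_distrib power_mult)
    finally show ?thesis .
  qed
  have "((\<lambda>k. \<Sum>j. f j k) \<longlongrightarrow> (\<Sum>j. l j * (v / 2) ^ (n * j) * bessel_tail n v 0 j)) (at_right 0)"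
  proof (rule tannerys_theorem[THEN conjunct2, THEN conjunct2])
    show "((\<lambda>k. f j k) \<longlongrightarrow> l j * (v / 2) ^ (n * j) * bessel_tail n v 0 j) (at_right 0)" for j
      unfolding f_def by (intro tendsto_intros l bessel_tail_tendsto)
    have "\<forall>\<^sub>F p in at_top \<times>\<^sub>F at_right (0 :: real). True \<and> snd p \<in> {0<..<1/2}"
      by (rule eventually_prodI) (simp_all only: eventually_True eventually_at_right_real[of 0 "1/2"] half_gt_zero zero_less_one)
    then show "\<forall>\<^sub>F (j, k) in at_top \<times>\<^sub>F at_right 0. norm (f j k) \<le> M j"
      by eventually_elim (use bound in auto)
    show "summable M"
      unfolding M_def by (intro summable_mult summable_power_div_fact)
  qed simp
  then show ?thesis
    unfolding normalized_series_def f_def by blast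
qed

section \<open>From the double series to the Horn functions\<close>

lemma horn_series_sums:
  fixes k v \<theta> \<phi> :: real
  assumes "0 < n" "0 < k"
  defines "c \<equiv> \<lambda>s. cos (\<theta> - \<phi> + 2 * pi * real s / real n)"
  shows "(\<lambda>j. pochhammer k j * pochhammer k j /
        (pochhammer (2 * k) j * pochhammer (real n * k) (n * j) * fact j) *
        (- 4 * (v / 2) ^ n * sin (real n * \<theta>) * sin (real n * \<phi>)) ^ j *
        horn_Phi2 n (\<lambda>_. k + real j) (real n * k + real n * real j) (\<lambda>s. v * c s))
    sums normalized_series n v (real n * \<theta>) (real n * \<phi>) k"
proof -
  define S where "S = sin (real n * \<theta>) * sin (real n * \<phi>)"
  define A where "A = {1..n} \<rightarrow>\<^sub>E (UNIV :: nat set)"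
  define \<mu> where "\<mu> = real n * k"
  define h where "h p = horn_coeff n k S c p * (v ^ horn_degree n p / pochhammer \<mu> (horn_degree n p))" for p
  define H where "H = (\<lambda>j J. (\<Prod>i=1..n. pochhammer (k + real j) (J i)) / pochhammer (\<mu> + real n * real j) (\<Sum>i=1..n. J i)
        * (\<Prod>i=1..n. (v * c i) ^ J i / fact (J i)))"
  define C where "C j = kernel_weight k j * (- 4 * (v / 2) ^ n * S) ^ j / pochhammer \<mu> (n * j)" for j
  have ab: "real n * \<theta> - real n * \<phi> = real n * (\<theta> - \<phi>)"
    by (simp add: algebra_simps)
  have c: "c i = cos (\<theta> - \<phi> + 2 * pi * real i / real n)" for i
    by (simp add: c_def)
  have eq: "h (j, J) = C j * H j J" for j J
  proof -
    \<comment> \<open>Splitting the weight after n j factors yields both the (n k)_(n j) of the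
      outer coefficient and the lower parameter n k + n j of the Horn function.\<close>
    have "pochhammer \<mu> (horn_degree n (j, J)) =
        pochhammer \<mu> (n * j) * pochhammer (\<mu> + real n * real j) (\<Sum>i=1..n. J i)"
      using pochhammer_product'[of \<mu> "n * j"] by (simp add: horn_degree_def)
    moreover have "(\<Prod>i=1..n. pochhammer (k + real j) (J i) / fact (J i) * (v * c i) ^ J i) =
        (\<Prod>i=1..n. pochhammer (k + real j) (J i)) * (\<Prod>i=1..n. (v * c i) ^ J i / fact (J i))"
      by (simp flip: prod.distrib)
    moreover have "h (j, J) = horn_coeff n k S c (j, J) * v ^ horn_degree n (j, J) / pochhammer \<mu> (horn_degree n (j, J))"
      by (simp add: h_def)
    ultimately show ?thesis
      unfolding horn_coeff_eq by (simp add: C_def H_def)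
  qed
  have "h summable_on (UNIV \<times> A)"
    unfolding h_def A_def S_def \<mu>_def by (rule bessel_horn_identity(3)[OF assms(1,2) ab c])
  then have h: "(\<lambda>(j, J). h (j, J)) summable_on (UNIV \<times> A)"
    by simp
  have "(\<lambda>j. infsum (\<lambda>J. h (j, J)) A) summable_on UNIV"
    by (rule summable_on_Sigma_banach[OF h])
  then have "((\<lambda>j. infsum (\<lambda>J. h (j, J)) A) has_sum (\<Sum>\<^sub>\<infinity>j. infsum (\<lambda>J. h (j, J)) A)) UNIV"
    by (rule has_sum_infsum)
  moreover have "(\<Sum>\<^sub>\<infinity>j. infsum (\<lambda>J. h (j, J)) A) = infsum h (UNIV \<times> A)"
    using infsum_Sigma'_banach[OF h] by simp
  moreover have "infsum h (UNIV \<times> A) = normalized_series n v (real n * \<theta>) (real n * \<phi>) k"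
    unfolding normalized_series_eq[OF assms(1,2)] h_def A_def S_def \<mu>_def
    by (rule bessel_horn_identity(4)[OF assms(1,2) ab c, symmetric])
  moreover have "infsum (\<lambda>J. h (j, J)) A = C j * infsum (H j) A" for j
    unfolding eq by (rule infsum_cmult_right')
  ultimately have "(\<lambda>j. C j * infsum (H j) A) sums normalized_series n v (real n * \<theta>) (real n * \<phi>) k"
    using has_sum_imp_sums by simp
  moreover have "infsum (H j) A =
      horn_Phi2 n (\<lambda>_. k + real j) (real n * k + real n * real j) (\<lambda>s. v * c s)" for j
    by (simp only: H_def A_def \<mu>_def horn_Phi2_def)
  then have "C j * infsum (H j) A = pochhammer k j * pochhammer k j /
        (pochhammer (2 * k) j * pochhammer (real n * k) (n * j) * fact j) *
        (- 4 * (v / 2) ^ n * sin (real n * \<theta>) * sin (real n * \<phi>)) ^ j *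
        horn_Phi2 n (\<lambda>_. k + real j) (real n * k + real n * real j) (\<lambda>s. v * c s)" for j
    by (simp add: C_def kernel_weight_def product_weight_def \<mu>_def S_def mult_ac)
  ultimately show ?thesis
    by simp
qed

text \<open>At k = 0 the right-hand side contains Gamma 0 and zero denominators (0)_j, so the
  identity is stated there as a limit from the right. For k > 0 summability is asserted as well,
  since otherwise the infinite sum would carry no meaning.\<close>

theorem corollary1:
  fixes n :: nat and k \<rho> \<phi> r \<theta> :: real and x y :: complex
  assumes "n \<ge> 3" and "k \<ge> 0"
    and "\<rho> \<ge> 0" and "x = rcis \<rho> \<phi>" and "x \<in> closure (dihedral_wedge n)"
    and "r \<ge> 0" and "y = rcis r \<theta>" and "y \<in> closure (dihedral_wedge n)"
  shows
    "let b = (\<lambda>s. cos (\<theta> - \<phi> + 2 * pi * real s / real n));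
         A = (\<lambda>\<kappa>. dihedral_const n \<kappa> /
                (real n * Beta (\<kappa> + 1/2) (1/2) * Gamma (real n * \<kappa>)));
         T = (\<lambda>\<kappa> j. pochhammer \<kappa> j * pochhammer \<kappa> j /
                (pochhammer (2 * \<kappa>) j * pochhammer (real n * \<kappa>) (n * j) * fact j) *
                (- 4 * (\<rho> * r / 2) ^ n * sin (real n * \<theta>) * sin (real n * \<phi>)) ^ j *
                horn_Phi2 n (\<lambda>_. \<kappa> + real j) (real n * \<kappa> + real n * real j)
                  (\<lambda>s. \<rho> * r * b s))
     in (k > 0 \<longrightarrow> summable (T k) \<and> dihedral_bessel n k x y = A k * (\<Sum>j. T k j)) \<and>
        (k = 0 \<longrightarrow> ((\<lambda>\<kappa>. A \<kappa> * (\<Sum>j. T \<kappa> j)) \<longlongrightarrow> dihedral_bessel n k x y) (at_right 0))"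
proof -
  define b where "b = (\<lambda>s. cos (\<theta> - \<phi> + 2 * pi * real s / real n))"
  define A where "A = (\<lambda>\<kappa>. dihedral_const n \<kappa> / (real n * Beta (\<kappa> + 1/2) (1/2) * Gamma (real n * \<kappa>)))"
  define T where "T = (\<lambda>\<kappa> j. pochhammer \<kappa> j * pochhammer \<kappa> j /
                (pochhammer (2 * \<kappa>) j * pochhammer (real n * \<kappa>) (n * j) * fact j) *
                (- 4 * (\<rho> * r / 2) ^ n * sin (real n * \<theta>) * sin (real n * \<phi>)) ^ j *
                horn_Phi2 n (\<lambda>_. \<kappa> + real j) (real n * \<kappa> + real n * real j)
                  (\<lambda>s. \<rho> * r * b s))"
  define D where "D = normalized_series n (\<rho> * r) (real n * \<theta>) (real n * \<phi>)"
  have n: "0 < n"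
    using assms(1) by simp
  have A: "A \<kappa> = 1" if "0 < \<kappa>" for \<kappa>
    unfolding A_def dihedral_const_eq[OF n that]
    by (rule divide_self) (use dihedral_normalization_pos[OF n that] in \<open>rule less_imp_neq[symmetric]\<close>)
  have T: "T \<kappa> sums D \<kappa>" if "0 < \<kappa>" for \<kappa>
    unfolding T_def D_def b_def by (rule horn_series_sums[OF n that])
  have AT: "A \<kappa> * (\<Sum>j. T \<kappa> j) = D \<kappa>" if "0 < \<kappa>" for \<kappa>
    using A[OF that] sums_unique[OF T[OF that]] by simp
  have B: "dihedral_const n \<kappa> * dihedral_bessel_unnormalized n \<kappa> x y = D \<kappa>" if "0 < \<kappa>" for \<kappa>
    unfolding D_def by (rule dihedral_normalized_bessel_eq[OF n that assms(3,4,6,7)])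
  have "summable (T k) \<and> dihedral_bessel n k x y = A k * (\<Sum>j. T k j)" if "0 < k"
    using T[OF that] that by (auto simp: A B dihedral_bessel_def sums_iff)
  moreover have "((\<lambda>\<kappa>. A \<kappa> * (\<Sum>j. T \<kappa> j)) \<longlongrightarrow> dihedral_bessel n k x y) (at_right 0)" if "k = 0"
  proof -
    obtain l where l: "(D \<longlongrightarrow> l) (at_right 0)"
      using normalized_series_converges_at_0[OF n, of "\<rho> * r"] assms(3,6) unfolding D_def by auto
    have ev: "\<forall>\<^sub>F \<kappa> in at_right 0. D \<kappa> = dihedral_const n \<kappa> * dihedral_bessel_unnormalized n \<kappa> x y"
      "\<forall>\<^sub>F \<kappa> in at_right 0. D \<kappa> = A \<kappa> * (\<Sum>j. T \<kappa> j)"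
      using eventually_at_right_less[of "0 :: real"] by (eventually_elim, simp add: AT B)+
    have "dihedral_bessel n k x y = l"
      using tendsto_Lim[OF trivial_limit_at_right_real Lim_transform_eventually[OF l ev(1)]] that
      by (simp add: dihedral_bessel_def)
    then show ?thesis
      using Lim_transform_eventually[OF l ev(2)] by simp
  qed
  ultimately have "(k > 0 \<longrightarrow> summable (T k) \<and> dihedral_bessel n k x y = A k * (\<Sum>j. T k j)) \<and>
      (k = 0 \<longrightarrow> ((\<lambda>\<kappa>. A \<kappa> * (\<Sum>j. T \<kappa> j)) \<longlongrightarrow> dihedral_bessel n k x y) (at_right 0))"
    by blast
  then show ?thesis
    unfolding Let_def A_def T_def b_def .
qed

end
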